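(* Let $G$ be a connected claw-free graph on $n$ vertices, and let $\mu(G)$ denote its spectral radius. If $\mu(G)\geq n-4$, then $G$ is traceable unless $G=N_{n-3,3}$.
   Context: All graphs are finite, simple and undirected. The spectral radius $\mu(G)$ of a graph $G$ is the spectral radius of its adjacency matrix, i.e. the maximum of the absolute values of the eigenvalues of the adjacency matrix (equivalently, its largest eigenvalue). A graph is claw-free if it contains no induced subgraph isomorphic to the claw $K_{1,3}$. A graph is traceable if it has a Hamilton path, i.e. a path containing all of its vertices. $N_{n-3,3}$ (for $n\ge 6$) denotes the graph on $n$ vertices consisting of a complete graph $K_{n-3}$ together with three disjoint pendant edges: three distinct vertices $a_1,a_2,a_3$ of $K_{n-3}$ are chosen and three new vertices $b_1,b_2,b_3$ are added, with $b_i$ adjacent only to $a_i$ for $i=1,2,3$. Equality of graphs means isomorphism. *)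

theory Defs
  imports "Graph_Theory.Graph_Theory" "Jordan_Normal_Form.Spectral_Radius"
begin

text \<open>
  Finite simple undirected graphs are the symmetric, loop-free digraphs without parallel arcs of
  the locale predicate \<^const>\<open>Digraph.graph\<close>: an undirected edge is a pair of opposite arcs.
\<close>

definition adjacency_matrix :: "('a, 'b) pre_digraph \<Rightarrow> 'a list \<Rightarrow> complex mat" where
  "adjacency_matrix G vs =
     mat (length vs) (length vs) (\<lambda>(i, j). if vs ! i \<rightarrow>\<^bsub>G\<^esub> vs ! j then 1 else 0)"

text \<open>The choice of the vertex enumeration is irrelevant, see \<open>graph_spectral_radius_eq\<close> below.\<close>

definition graph_spectral_radius :: "('a, 'b) pre_digraph \<Rightarrow> real" where
  "graph_spectral_radius G =
     spectral_radius (adjacency_matrix G (SOME vs. distinct vs \<and> set vs = verts G))"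

definition claw_free :: "('a, 'b) pre_digraph \<Rightarrow> bool" where
  "claw_free G \<longleftrightarrow> \<not> (\<exists>H. induced_subgraph H G \<and> K\<^bsub>1,3\<^esub> H)"

definition traceable :: "('a, 'b) pre_digraph \<Rightarrow> bool" where
  "traceable G \<longleftrightarrow>
     (\<exists>u p v. pre_digraph.apath G u p v \<and> set (pre_digraph.awalk_verts G u p) = verts G)"

text \<open>
  The complete graph on \<open>0, \<dots>, m - 1\<close> with \<open>k\<close> disjoint pendant edges, joining \<open>i\<close> to \<open>m + i\<close>
  for \<open>i < k\<close>. It is the intended graph only if \<open>k \<le> m\<close>.
\<close>

definition clique_with_pendants :: "nat \<Rightarrow> nat \<Rightarrow> nat pair_pre_digraph" where
  "clique_with_pendants m k =
     \<lparr> pverts = {..<m + k},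
       parcs = {(i, j). i < m \<and> j < m \<and> i \<noteq> j} \<union> (\<Union>i<k. {(i, m + i), (m + i, i)}) \<rparr>"

lemma pair_graph_clique_with_pendants:
  assumes "k \<le> m"
  shows "pair_graph (clique_with_pendants m k)"
proof -
  have "parcs (clique_with_pendants m k) \<subseteq> {..<m + k} \<times> {..<m + k}"
    using assms by (auto simp: clique_with_pendants_def)
  then have "finite (parcs (clique_with_pendants m k))"
    by (rule finite_subset) simp
  then show ?thesis
    using assms by unfold_locales (auto simp: clique_with_pendants_def symmetric_def intro!: symI)
qed

lemma spectrum_adjacency_matrix_mono:
  assumes "distinct vs" "distinct ws" "set vs = set ws"
  shows "spectrum (adjacency_matrix G vs) \<subseteq> spectrum (adjacency_matrix G ws)"
proof
  fix k assume "k \<in> spectrum (adjacency_matrix G vs)"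
  define n where "n = length vs"
  have n: "length vs = n" "length ws = n"
    using assms by (auto simp: n_def simp flip: distinct_card)
  define A B where "A = adjacency_matrix G vs" and "B = adjacency_matrix G ws"
  have AB [simp]: "dim_row A = n" "dim_row B = n" "A \<in> carrier_mat n n" "B \<in> carrier_mat n n"
    by (auto simp: A_def B_def adjacency_matrix_def n)
  from \<open>k \<in> _\<close> obtain x where x: "x \<in> carrier_vec n" "x \<noteq> 0\<^sub>v n" "A *\<^sub>v x = k \<cdot>\<^sub>v x"
    by (auto simp: spectrum_def eigenvalue_def eigenvector_def simp flip: A_def)
  have "bij_betw ((!) vs) {..<n} (set vs)" "bij_betw ((!) ws) {..<n} (set vs)"
    using assms n by (auto intro!: bij_betw_nth)
  then obtain p where p: "bij_betw p {..<n} {..<n}" "\<And>i. i < n \<Longrightarrow> vs ! p i = ws ! i"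
  proof -
    assume *: "\<And>p. bij_betw p {..<n} {..<n} \<Longrightarrow> (\<And>i. i < n \<Longrightarrow> vs ! p i = ws ! i) \<Longrightarrow> thesis"
      and bv: "bij_betw ((!) vs) {..<n} (set vs)" and bw: "bij_betw ((!) ws) {..<n} (set vs)"
    let ?p = "inv_into {..<n} ((!) vs) \<circ> (!) ws"
    show thesis
    proof (rule *[of ?p])
      show "bij_betw ?p {..<n} {..<n}"
        using bij_betw_trans[OF bw bij_betw_inv_into[OF bv]] .
      show "vs ! ?p i = ws ! i" if "i < n" for i
        using bij_betw_inv_into_right[OF bv, of "ws ! i"] bij_betwE[OF bw] that by auto
    qed
  qed
  have pn: "p i < n" if "i < n" for i
    using bij_betwE[OF p(1)] that by auto
  define y where "y = vec n (\<lambda>i. x $ p i)"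
  have "B *\<^sub>v y = k \<cdot>\<^sub>v y"
  proof (rule eq_vecI)
    fix i assume "i < dim_vec (k \<cdot>\<^sub>v y)"
    then have i: "i < n" by (simp add: y_def)
    have "(B *\<^sub>v y) $ i = (\<Sum>j\<in>{..<n}. A $$ (p i, p j) * x $ p j)"
      using i n pn by (auto simp: scalar_prod_def y_def A_def B_def adjacency_matrix_def p(2)
          atLeast0LessThan intro!: sum.cong)
    also have "\<dots> = (\<Sum>j\<in>{..<n}. A $$ (p i, j) * x $ j)"
      by (rule sum.reindex_bij_betw[OF p(1)])
    also have "\<dots> = (A *\<^sub>v x) $ p i"
      using i n pn x(1) by (auto simp: scalar_prod_def A_def adjacency_matrix_def
          atLeast0LessThan intro!: sum.cong)
    also have "\<dots> = (k \<cdot>\<^sub>v y) $ i"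
      using i pn x by (simp add: y_def)
    finally show "(B *\<^sub>v y) $ i = (k \<cdot>\<^sub>v y) $ i" .
  qed (simp add: y_def)
  moreover have "y \<noteq> 0\<^sub>v n"
  proof
    assume y0: "y = 0\<^sub>v n"
    have "x = 0\<^sub>v n"
    proof (rule eq_vecI)
      fix j assume "j < dim_vec (0\<^sub>v n :: complex vec)"
      then obtain i where "i < n" "j = p i"
        using p(1) by (auto simp: bij_betw_def)
      then have "x $ j = y $ i" by (simp add: y_def)
      with y0 \<open>i < n\<close> \<open>j < _\<close> show "x $ j = 0\<^sub>v n $ j" by simp
    qed (use x in auto)
    with x show False by simp
  qed
  moreover have "y \<in> carrier_vec n" by (simp add: y_def)
  ultimately show "k \<in> spectrum (adjacency_matrix G ws)"
    by (auto simp: spectrum_def eigenvalue_def eigenvector_def simp flip: B_def)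
qed

lemma graph_spectral_radius_eq:
  assumes "distinct vs" "set vs = verts G"
  shows "graph_spectral_radius G = spectral_radius (adjacency_matrix G vs)"
proof -
  let ?ws = "SOME ws. distinct ws \<and> set ws = verts G"
  have "distinct ?ws \<and> set ?ws = verts G"
    by (rule someI[of "\<lambda>ws. distinct ws \<and> set ws = verts G" vs]) (use assms in auto)
  then have "spectrum (adjacency_matrix G ?ws) = spectrum (adjacency_matrix G vs)"
    using assms by (intro equalityI spectrum_adjacency_matrix_mono) auto
  then show ?thesis
    by (simp add: graph_spectral_radius_def spectral_radius_def)
qed

end

theory Submission
  imports Defs "HOL-Analysis.Convex"
begin

text \<open>
  By Hong's bound \<open>\<mu>\<^sup>2 \<le> 2m - n + 1\<close> the hypothesis leaves at most \<open>3n - 8\<close> nonadjacent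
  pairs. Induction on \<open>n\<close> shows that a connected claw-free nontraceable graph with so few is
  \<open>N\<^bsub>n-3,3\<^esub>\<close> or one graph on seven vertices of spectral radius less than 3.

  If deleting some non-cut vertex with at least three nonneighbours leaves a nontraceable graph,
  the induction hypothesis applies to it, and explicit Hamilton paths leave few ways to add the
  vertex back. Otherwise let \<open>P = v\<^sub>1 v\<^sub>2 \<dots> v\<^sub>k\<close> be a longest path; it misses a single vertex
  \<open>u\<close>. The vertices \<open>u\<close>, \<open>v\<^sub>1\<close> and the successors on \<open>P\<close> of the neighbours of \<open>u\<close> are pairwise
  nonadjacent, and a claw-free graph with five pairwise nonadjacent vertices
  has too many nonadjacent pairs, so \<open>u\<close> has degree at most 2. Were it 2, a successor of a neighbour of \<open>u\<close> could play the role
  of \<open>u\<close>, but has degree at least 3. Hence \<open>u\<close> and likewise both ends of \<open>P\<close> are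
  pendant; this uses up all but one of the nonadjacent pairs, and claw-freeness makes the remaining
  vertices a clique.
\<close>

section \<open>Simple graphs as symmetric irreflexive relations\<close>

text \<open>The relation \<open>E\<close> stays fixed and every notion takes a vertex set
  \<open>V\<close>, so passing to an induced subgraph only means shrinking \<open>V\<close>.\<close>

locale ugraph =
  fixes E :: "'a \<Rightarrow> 'a \<Rightarrow> bool"
  assumes sym: "E x y \<Longrightarrow> E y x"
    and irrefl: "\<not> E x x"
begin

lemma sym_iff: "E x y \<longleftrightarrow> E y x"
  using sym by blast

lemma successively_rev_sym: "successively E (rev P) \<longleftrightarrow> successively E P"
proof -
  have "(\<lambda>x y. E y x) = E" by (intro ext) (rule sym_iff)
  then show ?thesis by (simp only: successively_rev)
qed

text \<open>Connectivity by cuts instead of walks: unions and maximal connected subsets can then be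
  handled by set algebra.\<close>

definition conn :: "'a set \<Rightarrow> bool" where
  "conn V \<longleftrightarrow> V \<noteq> {} \<and> (\<forall>S \<subseteq> V. S \<noteq> {} \<longrightarrow> S \<noteq> V \<longrightarrow> (\<exists>x\<in>S. \<exists>y\<in>V - S. E x y))"

definition clawfree :: "'a set \<Rightarrow> bool" where
  "clawfree V \<longleftrightarrow> (\<forall>c\<in>V. \<forall>x\<in>V. \<forall>y\<in>V. \<forall>z\<in>V.
     E c x \<longrightarrow> E c y \<longrightarrow> E c z \<longrightarrow> x \<noteq> y \<longrightarrow> x \<noteq> z \<longrightarrow> y \<noteq> z \<longrightarrow> E x y \<or> E x z \<or> E y z)"

definition nonnbs :: "'a set \<Rightarrow> 'a \<Rightarrow> 'a set" where
  "nonnbs V v = {w \<in> V. w \<noteq> v \<and> \<not> E v w}"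

text \<open>Nonadjacent pairs of distinct vertices are counted as ordered pairs, i.e. twice.\<close>

definition nonedges :: "'a set \<Rightarrow> nat" where
  "nonedges V = (\<Sum>v\<in>V. card (nonnbs V v))"

definition path_in :: "'a set \<Rightarrow> 'a list \<Rightarrow> bool" where
  "path_in V P \<longleftrightarrow> set P \<subseteq> V \<and> distinct P \<and> successively E P"

text \<open>The empty list makes \<open>ham {}\<close> true, so nonemptiness is supplied separately
  when a Hamilton path is turned into \<open>traceable\<close>.\<close>

definition ham :: "'a set \<Rightarrow> bool" where
  "ham V \<longleftrightarrow> (\<exists>P. path_in V P \<and> set P = V)"

subsection \<open>Connectivity\<close>

lemma conn_singleton: "conn {v}"
  by (auto simp: conn_def)

lemma conn_Un:
  assumes U: "conn U" and W: "conn W" and xy: "x \<in> U" "y \<in> W" "E x y"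
  shows "conn (U \<union> W)"
  unfolding conn_def
proof (intro conjI allI impI)
  show "U \<union> W \<noteq> {}" using xy by auto
  fix S assume S: "S \<subseteq> U \<union> W" "S \<noteq> {}" "S \<noteq> U \<union> W"
  have *: "\<exists>x\<in>S. \<exists>y\<in>U \<union> W - S. E x y"
    if "conn T" "T \<subseteq> U \<union> W" "S \<inter> T \<noteq> {}" "\<not> T \<subseteq> S" for T
  proof -
    have "S \<inter> T \<subseteq> T" "S \<inter> T \<noteq> T" using that by auto
    with that obtain x y where "x \<in> S \<inter> T" "y \<in> T - S \<inter> T" "E x y"
      unfolding conn_def by metis
    with that show ?thesis by blast
  qed
  show "\<exists>x\<in>S. \<exists>y\<in>U \<union> W - S. E x y"
  proof (cases "(S \<inter> U \<noteq> {} \<and> \<not> U \<subseteq> S) \<or> (S \<inter> W \<noteq> {} \<and> \<not> W \<subseteq> S)")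
    case True
    then show ?thesis using *[OF U] *[OF W] by auto
  next
    case False
    \<comment> \<open>A set \<open>S\<close> that cuts neither \<open>U\<close> nor \<open>W\<close>
      contains one of them and avoids the other, so the edge between \<open>x\<close> and
      \<open>y\<close> leaves it.\<close>
    then have "(x \<in> S \<and> y \<notin> S) \<or> (x \<notin> S \<and> y \<in> S)" using S xy by blast
    then show ?thesis using xy sym by blast
  qed
qed

lemma conn_insert: "conn U \<Longrightarrow> x \<in> U \<Longrightarrow> E x v \<Longrightarrow> conn (insert v U)"
  using conn_Un[OF _ conn_singleton, of U x v v] by simp

lemma conn_path: "successively E P \<Longrightarrow> P \<noteq> [] \<Longrightarrow> conn (set P)"
proof (induction P)
  case (Cons a P)
  show ?case
  proof (cases "P = []")
    case True then show ?thesis by (simp add: conn_singleton)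
  next
    case False
    with Cons have "conn (set P)" "E (hd P) a" by (auto simp: successively_Cons sym)
    then show ?thesis using conn_insert[of "set P" "hd P" a] False by simp
  qed
qed simp

lemma conn_edge_out:
  assumes "conn V" "S \<subseteq> V" "S \<noteq> {}" "S \<noteq> V"
  obtains x y where "x \<in> S" "y \<in> V - S" "E x y"
  using assms unfolding conn_def by metis

text \<open>A maximal connected proper subset containing \<open>W\<close> misses exactly one vertex,
  because the far end of any edge leaving it can be added.\<close>

lemma ex_noncut_vertex:
  assumes "finite V" "conn V" "conn W" "W \<subset> V"
  obtains v where "v \<in> V - W" "conn (V - {v})"
proof -
  let ?\<U> = "{U. conn U \<and> W \<subseteq> U \<and> U \<subset> V}"
  have "finite ?\<U>" by (rule finite_subset[of _ "Pow V"]) (use assms in auto)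
  moreover have "W \<in> ?\<U>" using assms by auto
  ultimately obtain U where U: "U \<in> ?\<U>" and max: "\<And>U'. U' \<in> ?\<U> \<Longrightarrow> U \<subseteq> U' \<Longrightarrow> U' = U"
    using finite_has_maximal[of ?\<U>] by (metis (lifting) empty_iff)
  have "U \<noteq> {}" using U by (auto simp: conn_def)
  with U assms obtain x y where xy: "x \<in> U" "y \<in> V - U" "E x y"
    using conn_edge_out[of V U] by blast
  then have "conn (insert y U)" using conn_insert U by blast
  with max[of "insert y U"] U xy have "insert y U = V" by blast
  then have "V - {y} = U" using xy by auto
  with U xy that show ?thesis by auto
qed

subsection \<open>Counting nonedges\<close>

lemma nonnbs_finite: "finite V \<Longrightarrow> finite (nonnbs V v)"
  by (simp add: nonnbs_def)

lemma nonedges_insert: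
  assumes "finite V" "v \<notin> V"
  shows "nonedges (insert v V) = nonedges V + 2 * card (nonnbs V v)"
proof -
  have "nonnbs (insert v V) w = nonnbs V w \<union> (if w \<in> nonnbs V v then {v} else {})" if "w \<in> V" for w
    using that assms by (auto simp: nonnbs_def sym_iff)
  moreover have "v \<notin> nonnbs V w" for w using assms by (auto simp: nonnbs_def)
  ultimately have "card (nonnbs (insert v V) w) = card (nonnbs V w) + (if w \<in> nonnbs V v then 1 else 0)"
    if "w \<in> V" for w using that assms by (auto simp: nonnbs_finite)
  then have "(\<Sum>w\<in>V. card (nonnbs (insert v V) w))
      = (\<Sum>w\<in>V. card (nonnbs V w)) + (\<Sum>w\<in>V. if w \<in> nonnbs V v then 1 else 0)"
    by (simp add: sum.distrib)
  also have "(\<Sum>w\<in>V. if w \<in> nonnbs V v then 1 else 0) = card (V \<inter> nonnbs V v)"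
    using assms by (simp add: sum.If_cases)
  also have "V \<inter> nonnbs V v = nonnbs V v" by (auto simp: nonnbs_def)
  also have "nonnbs (insert v V) v = nonnbs V v" by (auto simp: nonnbs_def)
  ultimately show ?thesis using assms by (simp add: nonedges_def)
qed

lemma card_nonnbs_pendant:
  assumes "finite V" "v \<notin> V" "\<forall>x\<in>V. E v x \<longrightarrow> x \<in> A" "finite A"
  shows "card V \<le> card (nonnbs V v) + card A"
proof -
  have "card V \<le> card (nonnbs V v \<union> A)"
    using assms by (intro card_mono) (auto simp: nonnbs_def)
  also have "\<dots> \<le> card (nonnbs V v) + card A" by (rule card_Un_le)
  finally show ?thesis .
qed

text \<open>Bounds \<open>nonedges\<close> from below while a graph is built up vertex by vertex.
  The additive form avoids truncated subtraction.\<close>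

lemma nonedges_insert_pendant:
  assumes "finite V" "v \<notin> V" "\<forall>x\<in>V. E v x \<longrightarrow> x \<in> A" "finite A"
  shows "nonedges (insert v V) + 2 * card A \<ge> nonedges V + 2 * card V"
  using card_nonnbs_pendant[OF assms] nonedges_insert[OF assms(1,2)] by linarith

lemma three_distinct:
  assumes "3 \<le> card A"
  obtains x y z where "x \<in> A" "y \<in> A" "z \<in> A" "x \<noteq> y" "x \<noteq> z" "y \<noteq> z"
proof -
  obtain B where B: "B \<subseteq> A" "card B = 3"
    using assms by (meson obtain_subset_with_card_n)
  then show ?thesis using that by (auto simp: card_3_iff)
qed

lemma three_le_card:
  assumes "finite A" "{x, y, z} \<subseteq> A" "distinct [x, y, z]"
  shows "3 \<le> card A"
proof -
  have "card {x, y, z} \<le> card A" using assms by (intro card_mono) auto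
  with assms show ?thesis by simp
qed

lemma clawfree_subset: "clawfree V \<Longrightarrow> W \<subseteq> V \<Longrightarrow> clawfree W"
  unfolding clawfree_def by (meson subsetD)

lemma clawfreeD:
  assumes "clawfree V" "{c, x, y, z} \<subseteq> V" "E c x" "E c y" "E c z" "x \<noteq> y" "x \<noteq> z" "y \<noteq> z"
  shows "E x y \<or> E x z \<or> E y z"
  using assms(1)[unfolded clawfree_def, rule_format, of c x y z] assms(2-) by simp

text \<open>In a claw-free graph a vertex outside an independent set has at most two neighbours in it.\<close>

lemma nonedges_independent_5:
  assumes "clawfree V" "finite V" "S \<subseteq> V" "card S = 5"
    and indep: "\<And>x y. x \<in> S \<Longrightarrow> y \<in> S \<Longrightarrow> \<not> E x y"
  shows "6 * card V \<le> nonedges V + 10"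
proof -
  have fS: "finite S" using assms finite_subset by blast
  \<comment> \<open>Grow \<open>S\<close> to \<open>V\<close> one vertex at a time. The start is 5 *
    4 = 6 * 5 - 10 ordered pairs; each further vertex misses at least three of the five vertices of
    \<open>S\<close> and so adds at least 6.\<close>
  have "6 * card (S \<union> D) \<le> nonedges (S \<union> D) + 10" if "finite D" "D \<subseteq> V - S" for D
    using that
  proof (induction D)
    case empty
    have "nonnbs S v = S - {v}" if "v \<in> S" for v using indep[of v] that by (auto simp: nonnbs_def)
    then have "nonedges S = (\<Sum>v\<in>S. 4)"
      unfolding nonedges_def by (intro sum.cong refl) (simp add: fS assms(4))
    then show ?case using assms by simp
  next
    case (insert w D)
    have "\<not> 3 \<le> card {x \<in> S. E w x}"
    proof
      assume "3 \<le> card {x \<in> S. E w x}"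
      then obtain x y z where "x \<in> {x \<in> S. E w x}" "y \<in> {x \<in> S. E w x}" "z \<in> {x \<in> S. E w x}"
        "x \<noteq> y" "x \<noteq> z" "y \<noteq> z" by (rule three_distinct)
      moreover from this have "{w, x, y, z} \<subseteq> V" using insert.prems assms(3) by auto
      ultimately show False using indep[of x y] indep[of x z] indep[of y z]
          clawfreeD[OF assms(1), of w x y z] by simp
    qed
    moreover have "card {x \<in> S. E w x} + card (nonnbs S w) = card S"
    proof -
      have "{x \<in> S. E w x} \<union> nonnbs S w = S" "{x \<in> S. E w x} \<inter> nonnbs S w = {}"
        using insert.prems by (auto simp: nonnbs_def)
      then show ?thesis using card_Un_disjoint[of "{x \<in> S. E w x}" "nonnbs S w"] fS
        by (simp add: nonnbs_finite)
    qed
    moreover have "card (nonnbs S w) \<le> card (nonnbs (S \<union> D) w)"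
      using fS insert.hyps by (intro card_mono) (auto simp: nonnbs_def)
    ultimately have "3 \<le> card (nonnbs (S \<union> D) w)" using assms(4) by linarith
    moreover have "nonedges (insert w (S \<union> D)) = nonedges (S \<union> D) + 2 * card (nonnbs (S \<union> D) w)"
      using fS insert by (intro nonedges_insert) auto
    moreover have "card (insert w (S \<union> D)) = Suc (card (S \<union> D))"
      using fS insert by (intro card_insert_disjoint) auto
    ultimately show ?case using insert by simp
  qed
  from this[of "V - S"] assms show ?thesis by (simp add: Un_absorb1)
qed

subsection \<open>Longest paths\<close>

definition longest :: "'a set \<Rightarrow> 'a list \<Rightarrow> bool" where
  "longest V P \<longleftrightarrow> path_in V P \<and> (\<forall>Q. path_in V Q \<longrightarrow> length Q \<le> length P)"

lemma path_in_length: "finite V \<Longrightarrow> path_in V P \<Longrightarrow> length P \<le> card V"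
  by (metis card_mono distinct_card path_in_def)

lemma ex_longest: "finite V \<Longrightarrow> \<exists>P. longest V P"
  using ex_has_greatest_nat[of "path_in V" "[]" length "Suc (card V)"] path_in_length[of V]
  unfolding longest_def by (fastforce simp: path_in_def less_Suc_eq_le)

lemma longest_if_misses_one:
  assumes "finite V" "\<not> ham V" "path_in V P" "set P = V - {u}" "u \<in> V"
  shows "longest V P"
  unfolding longest_def
proof (intro conjI allI impI)
  fix Q assume Q: "path_in V Q"
  have "length Q \<noteq> card V"
  proof
    assume "length Q = card V"
    then have "set Q = V" using Q assms(1) by (metis card_subset_eq distinct_card path_in_def)
    then show False using Q assms by (auto simp: ham_def)
  qed
  moreover have "length P = card V - 1"
    using assms by (metis card_Diff_singleton distinct_card path_in_def)
  ultimately show "length Q \<le> length P" using path_in_length[OF assms(1) Q] by linarith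
qed (use assms in auto)

lemma longestD: "longest V P \<Longrightarrow> path_in V Q \<Longrightarrow> length Q \<le> length P"
  by (simp add: longest_def)

lemma longest_rev: "longest V P \<Longrightarrow> longest V (rev P)"
  by (simp add: longest_def path_in_def sym_iff)

lemma split_at:
  assumes "Suc i < length P"
  shows "P = take i P @ [P ! i, P ! Suc i] @ drop (Suc (Suc i)) P"
  using assms by (simp add: Cons_nth_drop_Suc)

context
  fixes V P u i
  assumes P: "longest V P" and u: "u \<in> V" "u \<notin> set P"
    and i: "i < length P" "E u (P ! i)"
begin

text \<open>Throughout this context an excluded adjacency would let \<open>u\<close> be absorbed
  into a path longer than \<open>P\<close>; here \<open>u\<close> would be put before the first or
  after the last vertex.\<close>

lemma longest_nbr_inner: "0 < i" "Suc i < length P"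
proof -
  have ne: "P \<noteq> []" using i by auto
  have "\<not> E u (hd P)"
    using longestD[OF P, of "u # P"] P u ne by (auto simp: longest_def path_in_def successively_Cons)
  then show "0 < i" using i ne by (cases i) (auto simp: hd_conv_nth)
  have "\<not> E u (last P)"
    using longestD[OF P, of "P @ [u]"] P u ne
    by (auto simp: longest_def path_in_def successively_append_iff sym)
  then have "i \<noteq> length P - 1" using i ne by (auto simp: last_conv_nth)
  then show "Suc i < length P" using i by linarith
qed

lemma longest_split:
  obtains xs s ys where "P = xs @ [P ! i, s] @ ys" "s = P ! Suc i" "hd P = hd xs" "xs \<noteq> []" "length xs = i"
proof -
  have "take i P \<noteq> []" using longest_nbr_inner by (cases P) auto
  then show ?thesis using that[of "take i P"] split_at[OF longest_nbr_inner(2)] i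
    by (metis hd_append2 length_take min.absorb4)
qed

lemma longest_nbr_not_succ: "\<not> E u (P ! Suc i)"
proof
  assume *: "E u (P ! Suc i)"
  obtain xs s ys where s: "P = xs @ [P ! i, s] @ ys" "s = P ! Suc i" by (rule longest_split)
  define b where "b = P ! i"
  have Q: "P = xs @ [b, s] @ ys" "E u b" "E u s" using s * i by (auto simp: b_def)
  have "path_in V (xs @ [b, u, s] @ ys)"
    using P u Q by (auto simp: longest_def path_in_def successively_append_iff successively_Cons sym)
  from longestD[OF P this] Q(1) show False by simp
qed

text \<open>Otherwise \<open>P\<close> closes to a cycle, which can be opened just before
  \<open>P ! i\<close> and entered from \<open>u\<close>.\<close>

lemma longest_ends_nonadjacent: "\<not> E (hd P) (last P)"
proof
  assume *: "E (hd P) (last P)"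
  obtain xs s ys where s: "P = xs @ [P ! i, s] @ ys" "hd P = hd xs" "xs \<noteq> []" by (rule longest_split)
  define b where "b = P ! i"
  have Q: "P = xs @ [b, s] @ ys" "E u b" using s i by (auto simp: b_def)
  have "last P = last (s # ys)" unfolding Q(1) by simp
  with * s(2) have "E (last (s # ys)) (hd xs)" using sym by simp
  moreover have "path_in V (xs @ [b, s] @ ys)" "u \<notin> set (xs @ [b, s] @ ys)"
    using P u(2) unfolding Q(1) longest_def by simp_all
  ultimately have "path_in V (u # (b # s # ys) @ xs)"
    using u(1) Q(2) s(3) unfolding path_in_def
    by (auto simp: successively_append_iff successively_Cons hd_append split: if_splits)
  from longestD[OF P this] Q(1) show False by simp
qed

text \<open>Otherwise go from \<open>u\<close> to \<open>P ! i\<close>, back along \<open>P\<close>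
  to its head, across to \<open>P ! Suc i\<close> and on to the end.\<close>

lemma longest_hd_not_succ: "\<not> E (hd P) (P ! Suc i)"
proof
  assume *: "E (hd P) (P ! Suc i)"
  obtain xs s ys where s: "P = xs @ [P ! i, s] @ ys" "s = P ! Suc i" "hd P = hd xs" "xs \<noteq> []"
    by (rule longest_split)
  define b where "b = P ! i"
  have Q: "P = xs @ [b, s] @ ys" "E u b" "E (hd xs) s" using s * i by (auto simp: b_def)
  have "path_in V (u # b # rev xs @ s # ys)"
    using P u Q s(4) sym_iff
    by (auto simp: longest_def path_in_def successively_append_iff successively_Cons hd_rev last_rev sym)
  from longestD[OF P this] Q(1) show False by simp
qed

end

text \<open>The detour runs from \<open>b\<close> through \<open>u\<close> to \<open>c\<close>, then
  backwards through \<open>T\<close>, and from the first vertex of \<open>T\<close> across to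
  \<open>s\<close>.\<close>

lemma path_in_reroute:
  assumes P: "path_in V (ws @ [b] @ T @ [c, s] @ zs)" and "T \<noteq> []" "E (hd T) s"
    and u: "u \<in> V" "u \<notin> set (ws @ [b] @ T @ [c, s] @ zs)" "E u b" "E u c"
  shows "path_in V (ws @ [b, u, c] @ rev T @ s # zs)"
  unfolding path_in_def
proof (intro conjI)
  show "set (ws @ [b, u, c] @ rev T @ s # zs) \<subseteq> V" "distinct (ws @ [b, u, c] @ rev T @ s # zs)"
    using P u by (auto simp: path_in_def)
  have "E (last T) c" "E b u" using assms(1,2) sym[OF u(3)]
    by (auto simp: path_in_def successively_append_iff successively_Cons)
  then show "successively E (ws @ [b, u, c] @ rev T @ s # zs)"
    using assms sym[of "last T" c]
    by (simp add: path_in_def successively_append_iff successively_Cons successively_rev_sym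
      hd_rev last_rev del: successively_rev)
qed

lemma longest_succs_nonadjacent:
  assumes P: "longest V P" and u: "u \<in> V" "u \<notin> set P"
    and i: "i < j" "E u (P ! i)" and j: "j < length P" "E u (P ! j)"
  shows "\<not> E (P ! Suc i) (P ! Suc j)"
proof
  assume *: "E (P ! Suc i) (P ! Suc j)"
  \<comment> \<open>Two consecutive vertices of \<open>P\<close> cannot both be adjacent to
    \<open>u\<close>. Hence the segment \<open>T\<close> below is nonempty and starts with
    \<open>P ! Suc i\<close>.\<close>
  have "j \<noteq> Suc i" using longest_nbr_not_succ[OF P u _ i(2)] i j by auto
  have jl: "Suc j < length P" by (rule longest_nbr_inner(2)[OF P u j])
  define ws T zs where "ws = take i P" "T = drop (Suc i) (take j P)" "zs = drop (Suc (Suc j)) P"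
  have PT: "ws @ [P ! i] @ T @ [P ! j, P ! Suc j] @ zs = P"
  proof -
    have "ws @ [P ! i] @ T = take j P"
      using i j id_take_nth_drop[of i "take j P"] by (simp add: ws_T_zs_def)
    then have "(ws @ [P ! i] @ T) @ [P ! j, P ! Suc j] @ zs = P"
      using split_at[OF jl] by (simp only: ws_T_zs_def)
    then show ?thesis by (simp only: append_assoc)
  qed
  have T: "T \<noteq> []" "hd T = P ! Suc i"
    using i jl \<open>j \<noteq> Suc i\<close> by (auto simp: ws_T_zs_def hd_drop_conv_nth)
  have "path_in V (ws @ [P ! i, u, P ! j] @ rev T @ P ! Suc j # zs)"
    by (rule path_in_reroute, unfold PT) (use P T * u i(2) j(2) in \<open>simp_all add: longest_def\<close>)
  from longestD[OF P this] arg_cong[OF PT, of length] show False by simp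
qed

subsection \<open>Neighbours of a vertex missed by a longest path\<close>

lemma nonadj_sym: "\<not> E x y \<Longrightarrow> \<not> E y x"
  using sym by blast

context
  fixes V P u i
  assumes V: "clawfree V"
    and P: "longest V P" and u: "u \<in> V" "u \<notin> set P"
    and i: "i < length P" "E u (P ! i)"
begin

lemma longest_nbr_not_pred: "0 < i \<Longrightarrow> \<not> E u (P ! (i - 1))"
  using longest_nbr_not_succ[OF P u, of "i - 1"] i by (cases i) auto

lemma longest_in: "j < length P \<Longrightarrow> P ! j \<in> V" "distinct P"
  using P by (auto simp: longest_def path_in_def)

lemma longest_adj: "Suc j < length P \<Longrightarrow> E (P ! j) (P ! Suc j)"
  using P successively_nth by (fastforce simp: longest_def path_in_def)

text \<open>\<open>P ! i\<close> is adjacent to \<open>u\<close> and to both its neighbours on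
  \<open>P\<close>, and \<open>u\<close> is adjacent to neither of these two; only the chord between
  them prevents a claw.\<close>

lemma longest_chord: "E (P ! (i - 1)) (P ! Suc i)"
proof -
  note b = longest_nbr_inner[OF P u i]
  have "E (P ! i) u" "E (P ! i) (P ! (i - 1))" "E (P ! i) (P ! Suc i)"
    using i b longest_adj[of "i - 1"] longest_adj[of i] by (auto intro: sym)
  moreover have "{P ! i, u, P ! (i - 1), P ! Suc i} \<subseteq> V"
    using u b i longest_in(1) by auto
  moreover have "P ! (i - 1) \<noteq> P ! Suc i" "u \<noteq> P ! (i - 1)" "u \<noteq> P ! Suc i"
    using b i u longest_in(2) by (auto simp: nth_eq_iff_index_eq)
  ultimately show ?thesis
    using clawfreeD[OF V, of "P ! i" u "P ! (i - 1)" "P ! Suc i"]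
      longest_nbr_not_pred longest_nbr_not_succ[OF P u i] b by blast
qed

text \<open>For \<open>i = 1\<close> the chord would start at \<open>hd P\<close>, contradicting
  \<open>longest_hd_not_succ\<close>.\<close>

lemma longest_not_hd2: "2 \<le> i"
proof (rule ccontr)
  note b = longest_nbr_inner[OF P u i]
  assume "\<not> 2 \<le> i"
  then have "i = 1" using b by simp
  moreover have "hd P = P ! 0" using i by (intro hd_conv_nth) auto
  ultimately show False using longest_chord longest_hd_not_succ[OF P u i] by simp
qed

lemma longest_last_not_pred: "\<not> E (last P) (P ! (i - 1))" and longest_not_last2: "i + 3 \<le> length P"
proof -
  note b = longest_nbr_inner[OF P u i]
  \<comment> \<open>The position of \<open>P ! i\<close> in \<open>rev P\<close>, which is a longest
    path too; successors there are predecessors in \<open>P\<close>.\<close>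
  let ?i = "length P - Suc i"
  have *: "?i < length (rev P)" "E u (rev P ! ?i)" using i by (auto simp: rev_nth)
  have r: "rev P ! Suc ?i = P ! (i - 1)" "rev P ! (?i - 1) = P ! Suc i"
  proof -
    have "length P - Suc (Suc ?i) = i - 1" "length P - Suc (?i - 1) = Suc i"
      using b by linarith+
    then show "rev P ! Suc ?i = P ! (i - 1)" "rev P ! (?i - 1) = P ! Suc i"
      using b by (simp_all add: rev_nth)
  qed
  have u': "u \<notin> set (rev P)" using u by simp
  show "\<not> E (last P) (P ! (i - 1))"
    using longest_hd_not_succ[OF longest_rev[OF P] u(1) u' *] r by (simp add: hd_rev)
  \<comment> \<open>The chord joins \<open>P ! Suc i\<close> to \<open>P ! (i - 1)\<close>, which is
    not adjacent to \<open>last P\<close>.\<close>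
  then have "P ! Suc i \<noteq> last P" using longest_chord sym by metis
  moreover have "last P = P ! (length P - 1)" using i by (intro last_conv_nth) auto
  ultimately have "Suc i \<noteq> length P - 1" by metis
  then show "i + 3 \<le> length P" using b by linarith
qed

text \<open>Provides three nonneighbours for each of \<open>u\<close>, \<open>hd P\<close> and
  \<open>last P\<close>, the number required later to conclude that deleting such a vertex leaves a
  traceable graph.\<close>

lemma longest_ends_nonnbs:
  shows "{last P, P ! Suc i} \<subseteq> nonnbs V (hd P)"
    and "{hd P, P ! (i - 1)} \<subseteq> nonnbs V (last P)"
    and "{hd P, last P, P ! Suc i} \<subseteq> nonnbs V u"
    and "u \<in> nonnbs V (hd P)" "u \<in> nonnbs V (last P)"
    and "{hd P, u} \<subseteq> nonnbs V (P ! Suc i)"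
    and "distinct [u, hd P, last P, P ! Suc i, P ! (i - 1)]"
proof -
  note b = longest_not_hd2 longest_not_last2
  have "P \<noteq> []" using i by auto
  have hd: "hd P = P ! 0" using i by (intro hd_conv_nth) auto
  have la: "last P = P ! (length P - 1)" using i by (intro last_conv_nth) auto
  have d: "distinct [P ! 0, P ! (length P - 1), P ! Suc i, P ! (i - 1)]"
    using b i longest_in(2) \<open>P \<noteq> []\<close> by (auto simp: nth_eq_iff_index_eq)
  have uP: "u \<noteq> P ! j" if "j < length P" for j using u that by auto
  have I: "P ! 0 \<in> V" "P ! (length P - 1) \<in> V" "P ! Suc i \<in> V" "P ! (i - 1) \<in> V"
    using b longest_in(1) \<open>P \<noteq> []\<close> by auto
  have un: "u \<noteq> P ! 0" "u \<noteq> P ! (length P - 1)" "u \<noteq> P ! Suc i" "u \<noteq> P ! (i - 1)"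
    using b uP \<open>P \<noteq> []\<close> by auto
  have ne: "\<not> E u (P ! 0)" "\<not> E u (P ! (length P - 1))"
    using longest_nbr_inner[OF P u, of 0] longest_nbr_inner[OF P u, of "length P - 1"] b
    by fastforce+
  note ne = ne longest_nbr_not_succ[OF P u i] longest_hd_not_succ[OF P u i]
    longest_last_not_pred longest_ends_nonadjacent[OF P u i]
  note ne = ne[unfolded hd la]
  note ne = ne ne[THEN nonadj_sym]
  show "{last P, P ! Suc i} \<subseteq> nonnbs V (hd P)"
    and "{hd P, P ! (i - 1)} \<subseteq> nonnbs V (last P)"
    and "{hd P, last P, P ! Suc i} \<subseteq> nonnbs V u"
    and "u \<in> nonnbs V (hd P)" "u \<in> nonnbs V (last P)"
    and "{hd P, u} \<subseteq> nonnbs V (P ! Suc i)"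
    and "distinct [u, hd P, last P, P ! Suc i, P ! (i - 1)]"
    unfolding hd la nonnbs_def using I un ne d u by auto
qed

end

section \<open>Degree of a vertex whose deletion leaves a traceable graph\<close>

lemma card_nbs: "finite V \<Longrightarrow> v \<in> V \<Longrightarrow> card {w \<in> V. E v w} + card (nonnbs V v) + 1 = card V"
proof -
  assume V: "finite V" "v \<in> V"
  have "insert v ({w \<in> V. E v w} \<union> nonnbs V v) = V" "{w \<in> V. E v w} \<inter> nonnbs V v = {}"
    "v \<notin> {w \<in> V. E v w} \<union> nonnbs V v"
    using V irrefl by (auto simp: nonnbs_def)
  then show ?thesis
    using V card_insert_disjoint[of "{w \<in> V. E v w} \<union> nonnbs V v" v]
      card_Un_disjoint[of "{w \<in> V. E v w}" "nonnbs V v"]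
    by (simp add: nonnbs_finite)
qed

text \<open>The density hypothesis is what Hong's bound yields from \<open>\<mu>\<close> at least
  \<open>n - 4\<close>. It falls short of the bound in \<open>nonedges_independent_5\<close>, so
  \<open>u\<close>, \<open>hd P\<close> and the successors of three neighbours of \<open>u\<close>
  cannot be five pairwise nonadjacent vertices.\<close>

lemma degree_le_2_if_traceable_remove:
  assumes V: "finite V" "clawfree V" "\<not> ham V" "nonedges V + 15 \<le> 6 * card V"
    and u: "u \<in> V" "ham (V - {u})"
  shows "\<not> 3 \<le> card {w \<in> V. E u w}"
proof
  assume *: "3 \<le> card {w \<in> V. E u w}"
  from u(2) obtain P where P: "set P = V - {u}" "path_in (V - {u}) P" by (auto simp: ham_def)
  have L: "longest V P" using P V u
    by (intro longest_if_misses_one[of V P u]) (auto simp: path_in_def)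
  let ?I = "{i. i < length P \<and> E u (P ! i)}"
  have dP: "distinct P" using P by (auto simp: path_in_def)
  have "{w \<in> V. E u w} = (!) P ` ?I"
    using P(1) u irrefl by (auto simp: set_conv_nth image_iff)
  then have "3 \<le> card ?I" using * card_image_le[of ?I "(!) P"] by auto
  then obtain x y z where xyz: "x \<in> ?I" "y \<in> ?I" "z \<in> ?I" "x \<noteq> y" "x \<noteq> z" "y \<noteq> z"
    by (rule three_distinct)
  have up: "u \<notin> set P" using P by simp
  have ne: "\<not> E (P ! Suc i) (P ! Suc j)" if "i \<in> ?I" "j \<in> ?I" for i j
  proof (cases i j rule: linorder_cases)
    case less then show ?thesis using longest_succs_nonadjacent[OF L u(1) up, of i j] that by auto
  next
    case equal then show ?thesis by (simp add: irrefl)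
  next
    case greater
    then show ?thesis using longest_succs_nonadjacent[OF L u(1) up, of j i] that sym by auto
  qed
  have q: "{hd P, P ! Suc i} \<subseteq> nonnbs V u" "P ! Suc i \<in> nonnbs V (hd P)" "Suc i < length P" "hd P \<noteq> P ! Suc i"
    if "i \<in> ?I" for i
    using longest_ends_nonnbs[OF V(2) L u(1) up, of i] that longest_nbr_inner[OF L u(1) up, of i] by auto
  let ?S = "{u, hd P, P ! Suc x, P ! Suc y, P ! Suc z}"
  note Q = q[OF xyz(1)] q[OF xyz(2)] q[OF xyz(3)]
  have "distinct [u, hd P, P ! Suc x, P ! Suc y, P ! Suc z]"
    using Q xyz dP by (auto simp: nonnbs_def nth_eq_iff_index_eq)
  then have "card ?S = 5" using distinct_card by fastforce
  moreover have "?S \<subseteq> V" using Q u by (auto simp: nonnbs_def)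
  moreover have "\<not> E a b" if "a \<in> ?S" "b \<in> ?S" for a b
    using that Q ne[OF xyz(1) xyz(2)] ne[OF xyz(1) xyz(3)] ne[OF xyz(2) xyz(3)]
      ne[OF xyz(2) xyz(1)] ne[OF xyz(3) xyz(1)] ne[OF xyz(3) xyz(2)]
    by (auto simp: nonnbs_def irrefl dest: sym)
  ultimately have "6 * card V \<le> nonedges V + 10" using nonedges_independent_5[OF V(2,1)] by blast
  with V(4) show False by simp
qed

text \<open>
  The paper's graph \<open>N\<^bsub>n-3,3\<^esub>\<close> on the vertex set \<open>V\<close>, with clique \<open>K\<close> and pendant edges
  \<open>a\<^sub>i b\<^sub>i\<close>.
\<close>

definition net :: "'a set \<Rightarrow> 'a set \<Rightarrow> 'a \<Rightarrow> 'a \<Rightarrow> 'a \<Rightarrow> 'a \<Rightarrow> 'a \<Rightarrow> 'a \<Rightarrow> bool" where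
  "net V K a1 a2 a3 b1 b2 b3 \<longleftrightarrow> V = K \<union> {b1, b2, b3} \<and> {a1, a2, a3} \<subseteq> K \<and>
     distinct [a1, a2, a3, b1, b2, b3] \<and> {b1, b2, b3} \<inter> K = {} \<and>
     (\<forall>x\<in>K. \<forall>y\<in>K. x \<noteq> y \<longrightarrow> E x y) \<and>
     (\<forall>x\<in>V. E b1 x \<longleftrightarrow> x = a1) \<and> (\<forall>x\<in>V. E b2 x \<longleftrightarrow> x = a2) \<and> (\<forall>x\<in>V. E b3 x \<longleftrightarrow> x = a3)"

section \<open>Three pendant vertices force the net\<close>

lemma conn_ex_nbr:
  assumes "conn V" "v \<in> V" "V \<noteq> {v}"
  obtains w where "w \<in> V" "E v w"
  using conn_edge_out[of V "{v}"] assms by auto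

text \<open>Adding three pendant vertices to \<open>K\<close> creates at least
  \<open>6 * card K\<close> ordered nonadjacent pairs, while at most \<open>6 * card K + 3\<close>
  are allowed. So \<open>K\<close> misses at most one edge, and a claw excludes even that.\<close>

lemma net_if_three_pendants:
  assumes V: "finite V" "clawfree V" "conn V" "nonedges V + 15 \<le> 6 * card V"
    and b: "{b1, b2, b3} \<subseteq> V" "distinct [b1, b2, b3]" "\<not> E b1 b2" "\<not> E b1 b3" "\<not> E b2 b3"
    and d: "\<And>v. v \<in> {b1, b2, b3} \<Longrightarrow> card {w \<in> V. E v w} \<le> 1"
  shows "\<exists>K a1 a2 a3. net V K a1 a2 a3 b1 b2 b3"
proof -
  define K where "K = V - {b1, b2, b3}"
  have fK: "finite K" using V by (simp add: K_def)
  have pend: "\<exists>a. \<forall>x\<in>V. E v x \<longleftrightarrow> x = a" "\<exists>a\<in>V. E v a" if v: "v \<in> {b1, b2, b3}" for v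
  proof -
    have "V \<noteq> {v}" using b by auto
    then obtain a where a: "a \<in> V" "E v a" using conn_ex_nbr[OF V(3), of v] v b by auto
    then show "\<exists>a\<in>V. E v a" by blast
    have "x = a" if "x \<in> V" "E v x" for x
      using d[OF v] that a V(1) by (simp add: card_le_Suc0_iff_eq)
    with a have "\<forall>x\<in>V. E v x \<longleftrightarrow> x = a" by blast
    then show "\<exists>a. \<forall>x\<in>V. E v x \<longleftrightarrow> x = a" by blast
  qed
  then obtain a1 a2 a3 where a: "\<forall>x\<in>V. E b1 x \<longleftrightarrow> x = a1" "\<forall>x\<in>V. E b2 x \<longleftrightarrow> x = a2"
      "\<forall>x\<in>V. E b3 x \<longleftrightarrow> x = a3" "a1 \<in> V" "a2 \<in> V" "a3 \<in> V"
    by (metis insert_iff)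
  have ab: "E b1 a1" "E b2 a2" "E b3 a3" using a by auto
  have aK: "a1 \<in> K" "a2 \<in> K" "a3 \<in> K"
  proof -
    have "a1 \<notin> {b1, b2, b3}" "a2 \<notin> {b1, b2, b3}" "a3 \<notin> {b1, b2, b3}"
      using ab b sym irrefl[of b1] irrefl[of b2] irrefl[of b3] by fast+
    then show "a1 \<in> K" "a2 \<in> K" "a3 \<in> K" using a by (auto simp: K_def)
  qed
  have VK: "V = insert b1 (insert b2 (insert b3 K))" using b by (auto simp: K_def)
  have bK: "b1 \<notin> K" "b2 \<notin> K" "b3 \<notin> K" by (auto simp: K_def)
  have cV: "card V = card K + 3" unfolding VK using bK fK b by simp
  have "nonedges (insert b3 K) + 2 * card {a3} \<ge> nonedges K + 2 * card K"
    by (rule nonedges_insert_pendant) (use fK bK a VK in auto)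
  moreover have "nonedges (insert b2 (insert b3 K)) + 2 * card {a2} \<ge> nonedges (insert b3 K) + 2 * card (insert b3 K)"
    by (rule nonedges_insert_pendant) (use fK bK a VK b in auto)
  moreover have "nonedges V + 2 * card {a1} \<ge> nonedges (insert b2 (insert b3 K)) + 2 * card (insert b2 (insert b3 K))"
    unfolding VK by (rule nonedges_insert_pendant) (use fK bK a VK b in auto)
  moreover have "card (insert b3 K) = card K + 1" "card (insert b2 (insert b3 K)) = card K + 2"
    using fK bK b by auto
  ultimately have NK: "nonedges K \<le> 3" using V(4) cV by simp
  \<comment> \<open>Two pendant vertices at the same \<open>a\<close> form a claw with a third
    neighbour of \<open>a\<close>, which exists because the remaining pendant vertex must be
    connected to them.\<close>
  have same: False if h: "v \<in> {b1,b2,b3}" "w \<in> {b1,b2,b3}" "v \<noteq> w" "a \<in> K" "E v a" "E w a" for v w a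
  proof -
    have vw: "\<forall>x\<in>V. E v x \<longrightarrow> x = a" "\<forall>x\<in>V. E w x \<longrightarrow> x = a"
      using pend(1)[OF h(1)] pend(1)[OF h(2)] h(4-6) by (auto simp: K_def)
    obtain x y where "x \<in> {a, v, w}" "y \<in> V - {a, v, w}" "E x y"
    proof (rule conn_edge_out[OF V(3), of "{a, v, w}"])
      show "{a, v, w} \<noteq> V"
      proof
        assume "{a, v, w} = V"
        then have "{b1, b2, b3} \<subseteq> {v, w}" using b(1) bK h(4) by blast
        from card_mono[OF _ this] have "card {b1, b2, b3} \<le> 2" by (simp add: card_insert_if split: if_splits)
        then show False using b(2) by simp
      qed
      show "{a, v, w} \<subseteq> V" using h(1,2,4) b(1) by (auto simp: K_def)
    qed auto
    then have y: "E a y" "y \<in> V" "y \<noteq> v" "y \<noteq> w" "y \<noteq> a" using vw by auto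
    have av: "E a v" "E a w" using sym h(5,6) by simp_all
    have "v \<in> V" "w \<in> V" "a \<in> V" using h(1,2,4) b(1) by (auto simp: K_def)
    moreover have "w \<noteq> a" using h(2,4) bK by auto
    ultimately have "\<not> E v w" "\<not> E v y" "\<not> E w y" using vw y(2,5) by metis+
    then show False
      using clawfreeD[OF V(2) _ av y(1)] h(3) y \<open>v \<in> V\<close> \<open>w \<in> V\<close> \<open>a \<in> V\<close> by auto
  qed
  have d3: "a1 \<noteq> a2" "a1 \<noteq> a3" "a2 \<noteq> a3"
    using same[of b1 b2 a1] same[of b1 b3 a1] same[of b2 b3 a2] ab aK b by auto
  have clique: "E p q" if pq: "p \<in> K" "q \<in> K" "p \<noteq> q" for p q
  proof (rule ccontr)
    assume npq: "\<not> E p q"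
    \<comment> \<open>A second missing edge would give four ordered pairs in \<open>K\<close>, but
      \<open>nonedges K\<close> is at most 3.\<close>
    have only: "{x, y} = {p, q}" if "x \<in> K" "y \<in> K" "x \<noteq> y" "\<not> E x y" for x y
    proof (rule ccontr)
      assume ne: "{x, y} \<noteq> {p, q}"
      have "(SIGMA v:K. nonnbs K v) \<supseteq> {(p, q), (q, p), (x, y), (y, x)}"
        using that pq npq sym by (auto simp: nonnbs_def)
      moreover have "finite (SIGMA v:K. nonnbs K v)" using fK by (auto simp: nonnbs_finite)
      ultimately have "card {(p, q), (q, p), (x, y), (y, x)} \<le> card (SIGMA v:K. nonnbs K v)"
        by (rule card_mono[rotated])
      also have "\<dots> = nonedges K" using fK by (simp add: nonedges_def nonnbs_finite)
      finally show False using NK ne pq that by (auto simp: doubleton_eq_iff)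
    qed
    \<comment> \<open>An attachment vertex \<open>a\<close> other than \<open>p\<close> and
      \<open>q\<close> would be the centre of a claw with leaves \<open>p\<close>, \<open>q\<close>
      and its pendant vertex. One of the three attachment vertices is such an
      \<open>a\<close>.\<close>
    have step: False if h: "a \<in> K" "a \<noteq> p" "a \<noteq> q" "E v a" "v \<in> {b1, b2, b3}" for a v
    proof -
      have "E a p" using only[OF h(1) pq(1) h(2)] h(2,3) by (auto simp: doubleton_eq_iff)
      moreover have "E a q" using only[OF h(1) pq(2) h(3)] h(2,3) by (auto simp: doubleton_eq_iff)
      moreover have V': "a \<in> V" "p \<in> V" "q \<in> V" "v \<in> V" using h(1,5) pq b(1) by (auto simp: K_def)
      moreover have "v \<noteq> p" "v \<noteq> q" using pq h(5) by (auto simp: K_def)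
      moreover have "\<not> E v p" "\<not> E v q" using pend(1)[OF h(5)] h(2,3,4) V' by metis+
      ultimately show False
        using clawfreeD[OF V(2) _ sym[OF h(4)], of p q] npq pq(3) by simp
    qed
    show False using step[of a1 b1] step[of a2 b2] step[of a3 b3] aK ab d3 by auto
  qed
  have "net V K a1 a2 a3 b1 b2 b3"
    unfolding net_def using VK aK d3 b bK clique a by auto
  then show ?thesis by blast
qed

text \<open>
  The net with one pendant edge replaced by a pendant triangle: on seven vertices it also has
  enough edges, and only its spectral radius, which is less than 3, excludes it.
\<close>

definition triangle_net :: "'a set \<Rightarrow> 'a \<Rightarrow> 'a \<Rightarrow> 'a \<Rightarrow> 'a \<Rightarrow> 'a \<Rightarrow> 'a \<Rightarrow> 'a \<Rightarrow> bool" where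
  "triangle_net V a1 a2 a3 b1 c b2 b3 \<longleftrightarrow> V = {a1, a2, a3, b1, c, b2, b3} \<and> distinct [a1, a2, a3, b1, c, b2, b3] \<and>
     E a1 a2 \<and> E a1 a3 \<and> E a2 a3 \<and> E a1 b1 \<and> E a1 c \<and> E b1 c \<and> E a2 b2 \<and> E a3 b3 \<and>
     (\<forall>x\<in>V. E b1 x \<longrightarrow> x \<in> {a1, c}) \<and> (\<forall>x\<in>V. E c x \<longrightarrow> x \<in> {a1, b1}) \<and>
     (\<forall>x\<in>V. E b2 x \<longrightarrow> x \<in> {a2}) \<and> (\<forall>x\<in>V. E b3 x \<longrightarrow> x \<in> {a3})"

lemma hamI: "set P = V \<Longrightarrow> distinct P \<Longrightarrow> successively E P \<Longrightarrow> ham V"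
  by (auto simp: ham_def path_in_def)

lemma length_le_card: "finite A \<Longrightarrow> set xs \<subseteq> A \<Longrightarrow> distinct xs \<Longrightarrow> length xs \<le> card A"
  by (metis card_mono distinct_card)

text \<open>Two neighbours \<open>P ! i\<close> and \<open>P ! j\<close> of \<open>u\<close> make
  \<open>P ! Suc i\<close> a non-cut vertex with three nonneighbours. By \<open>irr\<close> its
  deletion leaves a traceable graph, so its degree is at most 2, but the chord raises it to
  3.\<close>

lemma degree_le_1_if_traceable_remove:
  assumes V: "finite V" "clawfree V" "\<not> ham V" "nonedges V + 15 \<le> 6 * card V"
    and irr: "\<And>v. v \<in> V \<Longrightarrow> conn (V - {v}) \<Longrightarrow> 3 \<le> card (nonnbs V v) \<Longrightarrow> ham (V - {v})"
    and u: "u \<in> V" "ham (V - {u})"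
  shows "card {w \<in> V. E u w} \<le> 1"
proof (rule ccontr)
  assume "\<not> ?thesis"
  then have "\<not> (\<forall>x\<in>{w \<in> V. E u w}. \<forall>y\<in>{w \<in> V. E u w}. x = y)"
    using V(1) by (simp add: card_le_Suc0_iff_eq)
  then obtain x y where xy: "x \<in> V" "y \<in> V" "E u x" "E u y" "x \<noteq> y" by auto
  from u(2) obtain P where P: "set P = V - {u}" "path_in (V - {u}) P" by (auto simp: ham_def)
  have L: "longest V P" using P V u
    by (intro longest_if_misses_one[of V P u]) (auto simp: path_in_def)
  have dP: "distinct P" "successively E P" using P by (auto simp: path_in_def)
  have "x \<in> set P" "y \<in> set P" using xy P irrefl by auto
  then obtain k l where kl: "k < length P" "l < length P" "P ! k = x" "P ! l = y"
    by (auto simp: in_set_conv_nth)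
  define i j where "i = min k l" "j = max k l"
  have "k \<noteq> l" using kl xy by auto
  then have ij: "i < j" "j < length P" "E u (P ! i)" "E u (P ! j)"
    using kl xy by (auto simp: i_j_def min_def max_def)
  have il: "i < length P" using ij by simp
  have up: "u \<notin> set P" using P by simp
  have "j \<noteq> Suc i" using longest_nbr_not_succ[OF L u(1) up il ij(3)] ij by auto
  then have ij': "Suc i < j" using ij by simp
  note b = longest_not_hd2[OF V(2) L u(1) up il ij(3)]
  have jl: "Suc j < length P" by (rule longest_nbr_inner(2)[OF L u(1) up ij(2,4)])
  \<comment> \<open>Without \<open>P ! Suc i\<close> the path falls into the pieces \<open>A\<close>
    and \<open>B\<close>; \<open>u\<close> reconnects them, being adjacent to \<open>P ! i\<close>
    in \<open>A\<close> and to \<open>P ! j\<close> in \<open>B\<close>.\<close>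
  define A B where "A = set (take (Suc i) P)" "B = set (drop (Suc (Suc i)) P)"
  have PiA: "P ! i \<in> A" using il by (auto simp: A_B_def in_set_conv_nth)
  have PjB: "P ! j \<in> B"
  proof -
    have "P ! j = drop (Suc (Suc i)) P ! (j - Suc (Suc i))"
    proof -
      have "Suc (Suc (j - 2)) = j" using ij' by linarith
      then show ?thesis using ij' jl by simp
    qed
    moreover have "j - Suc (Suc i) < length (drop (Suc (Suc i)) P)" using ij' jl by simp
    ultimately show ?thesis unfolding A_B_def by (metis nth_mem)
  qed
  have Psplit: "P = take (Suc i) P @ P ! Suc i # drop (Suc (Suc i)) P"
    using ij ij' by (intro id_take_nth_drop) simp
  have sA: "successively E (take (Suc i) P)" "successively E (drop (Suc (Suc i)) P)"
    using dP(2) by (metis append_take_drop_id successively_append_iff)+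
  have "conn A" unfolding A_B_def by (rule conn_path) (use sA il in auto)
  moreover have "conn B" unfolding A_B_def by (rule conn_path) (use sA ij ij' in auto)
  then have "conn (insert u B)" by (rule conn_insert) (use PjB ij sym in auto)
  ultimately have "conn (A \<union> insert u B)"
    using conn_Un PiA sym[OF ij(3)] by blast
  moreover have "A \<union> insert u B = V - {P ! Suc i}"
  proof -
    have "distinct (take (Suc i) P @ P ! Suc i # drop (Suc (Suc i)) P)"
      using dP(1) Psplit by metis
    then have "P ! Suc i \<notin> A" "P ! Suc i \<notin> B" by (auto simp: A_B_def)
    moreover have "set P = A \<union> insert (P ! Suc i) B"
      using arg_cong[OF Psplit, of set] by (simp add: A_B_def)
    moreover have "P ! Suc i \<noteq> u" using up nth_mem[of "Suc i" P] ij ij' by auto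
    moreover have "V = insert u (set P)" using P(1) u by auto
    ultimately show ?thesis by blast
  qed
  moreover have "3 \<le> card (nonnbs V (P ! Suc i))"
  proof (rule three_le_card[of _ u "hd P" "P ! Suc j"])
    note l = longest_ends_nonnbs[OF V(2) L u(1) up il ij(3)]
      longest_ends_nonnbs[OF V(2) L u(1) up ij(2,4)]
    have "P ! Suc j \<in> nonnbs V (P ! Suc i)"
      using longest_succs_nonadjacent[OF L u(1) up ij(1,3,2,4)] jl P(1) ij(1) dP(1) nth_mem[OF jl]
      by (auto simp: nonnbs_def nth_eq_iff_index_eq)
    with l show "{u, hd P, P ! Suc j} \<subseteq> nonnbs V (P ! Suc i)" by auto
    from l show "distinct [u, hd P, P ! Suc j]" by auto
  qed (use V in \<open>simp add: nonnbs_finite\<close>)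
  moreover have "P ! Suc i \<in> V" using P(1) nth_mem[of "Suc i" P] ij ij' by auto
  ultimately have "\<not> 3 \<le> card {w \<in> V. E (P ! Suc i) w}"
    using irr degree_le_2_if_traceable_remove[OF V] by metis
  \<comment> \<open>Its two neighbours on \<open>P\<close> and, by the chord over
    \<open>P ! i\<close>, the vertex \<open>P ! (i - 1)\<close>.\<close>
  moreover have "3 \<le> card {w \<in> V. E (P ! Suc i) w}"
  proof (rule three_le_card[of _ "P ! (i - 1)" "P ! i" "P ! Suc (Suc i)"])
    have "E (P ! i) (P ! Suc i)" "E (P ! Suc i) (P ! Suc (Suc i))"
      using dP(2) ij ij' by (auto intro: successively_nth)
    then show "{P ! (i - 1), P ! i, P ! Suc (Suc i)} \<subseteq> {w \<in> V. E (P ! Suc i) w}"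
      using sym[OF longest_chord[OF V(2) L u(1) up il ij(3)]] sym[of "P ! i"] ij ij'
        P(1) nth_mem[of "i - 1" P] nth_mem[of i P] nth_mem[of "Suc (Suc i)" P] jl by auto
    show "distinct [P ! (i - 1), P ! i, P ! Suc (Suc i)]"
      using dP(1) b ij ij' by (auto simp: nth_eq_iff_index_eq)
  qed (use V in simp)
  ultimately show False by simp
qed

text \<open>Assumption \<open>irr\<close> is the case in which no deletion permits induction. It is
  applied to the missed vertex and to both ends of a longest path, which therefore all have degree
  at most 1.\<close>

lemma net_if_irreducible:
  assumes V: "finite V" "clawfree V" "\<not> ham V" "nonedges V + 15 \<le> 6 * card V" and c: "conn V"
    and irr: "\<And>v. v \<in> V \<Longrightarrow> conn (V - {v}) \<Longrightarrow> 3 \<le> card (nonnbs V v) \<Longrightarrow> ham (V - {v})"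
  shows "\<exists>K a1 a2 a3 b1 b2 b3. net V K a1 a2 a3 b1 b2 b3"
proof -
  obtain P where L: "longest V P" using ex_longest[OF V(1)] by blast
  obtain v0 where "v0 \<in> V" using c by (auto simp: conn_def)
  then have "path_in V [v0]" by (simp add: path_in_def)
  from longestD[OF L this] have ne: "P \<noteq> []" by auto
  have dP: "set P \<subseteq> V" "distinct P" "successively E P" using L by (auto simp: longest_def path_in_def)
  have cP: "conn (set P)" using conn_path dP ne by blast
  have sP: "set P \<subset> V" using dP V(3) hamI[of P V] by auto
  have nb: "\<exists>i. i < length P \<and> E u x \<and> x = P ! i" if "x \<in> set P" "E u x" for u x
    using that by (auto simp: in_set_conv_nth)
  obtain x w where xw: "x \<in> set P" "w \<in> V - set P" "E x w"
    using conn_edge_out[OF c, of "set P"] sP ne by auto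
  then obtain i0 where "i0 < length P" "E w (P ! i0)" using nb[of x w] sym by blast
  from longest_not_last2[OF V(2) L _ _ this] xw have l3: "3 \<le> length P" by auto
  obtain u where u: "u \<in> V - set P" "conn (V - {u})"
    using ex_noncut_vertex[OF V(1) c cP sP] by blast
  have uV: "u \<in> V" and up: "u \<notin> set P" using u by auto
  \<comment> \<open>If \<open>u\<close> has no neighbour on \<open>P\<close>, all vertices of
    \<open>P\<close> are nonneighbours, and there are at least three of them.\<close>
  have "3 \<le> card (nonnbs V u)"
  proof (cases "\<exists>x\<in>set P. E u x")
    case True
    then obtain i where i: "i < length P" "E u (P ! i)" using nb by blast
    note l = longest_ends_nonnbs[OF V(2) L uV up i]
    show ?thesis
      by (rule three_le_card[of _ "hd P" "last P" "P ! Suc i"]) (use V l in \<open>auto simp: nonnbs_finite\<close>)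
  next
    case False
    then have "set P \<subseteq> nonnbs V u" using dP u by (auto simp: nonnbs_def)
    then have "length P \<le> card (nonnbs V u)" using V dP by (intro length_le_card) (auto simp: nonnbs_finite)
    with l3 show ?thesis by simp
  qed
  with irr u have hu: "ham (V - {u})" by blast
  then obtain Q where Q: "set Q = V - {u}" "path_in (V - {u}) Q" by (auto simp: ham_def)
  \<comment> \<open>A Hamilton path of \<open>V - {u}\<close> is no longer than \<open>P\<close>, so
    \<open>P\<close> itself misses only \<open>u\<close>.\<close>
  then have "length Q \<le> length P" by (intro longestD[OF L]) (auto simp: path_in_def)
  then have "card (V - {u}) \<le> card (set P)" using Q dP by (metis distinct_card path_in_def)
  then have SP: "set P = V - {u}" using card_seteq[of "V - {u}" "set P"] dP V u by auto
  have "V \<noteq> {u}" using dP ne up by (metis all_not_in_conv insert_absorb set_empty singletonD subset_singletonD)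
  then obtain y where "y \<in> V" "E u y" using conn_ex_nbr[OF c uV] by metis
  then obtain i where i: "i < length P" "E u (P ! i)" using nb SP irrefl by blast
  note l = longest_ends_nonnbs[OF V(2) L uV up i]
  note b = longest_not_hd2[OF V(2) L uV up i] longest_not_last2[OF V(2) L uV up i]
  \<comment> \<open>Deleting an end of \<open>P\<close> leaves a path to which \<open>u\<close> is
    still attached at \<open>P ! i\<close>, since \<open>P ! i\<close> is an inner vertex.\<close>
  have h1: "ham (V - {hd P})"
  proof (rule irr)
    have P: "P = hd P # tl P" using ne by simp
    have "successively E (tl P)" "tl P \<noteq> []"
      using dP(3) l3 by (cases P; auto simp: successively_Cons)+
    then have "conn (set (tl P))" by (rule conn_path)
    moreover have "P ! i \<in> set (tl P)"
      using nth_mem[of "i - 1" "tl P"] b i by (simp add: nth_tl)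
    ultimately have "conn (insert u (set (tl P)))" using conn_insert sym i by blast
    moreover have "insert u (set (tl P)) = V - {hd P}"
    proof -
      have "hd P \<notin> set (tl P)" "set P = insert (hd P) (set (tl P))" using dP(2) P by (metis distinct.simps(2), metis list.set(2))
      then show ?thesis using SP uV up by auto
    qed
    ultimately show "conn (V - {hd P})" by simp
    show "3 \<le> card (nonnbs V (hd P))"
      by (rule three_le_card[of _ u "last P" "P ! Suc i"]) (use V l in \<open>auto simp: nonnbs_finite\<close>)
  qed (use dP ne in auto)
  have h2: "ham (V - {last P})"
  proof (rule irr)
    have P: "P = butlast P @ [last P]" using ne by simp
    have "successively E (butlast P)" using dP(3) P by (metis successively_append_iff)
    moreover have "butlast P \<noteq> []" using l3 length_butlast[of P] by (cases "butlast P") auto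
    ultimately have "conn (set (butlast P))" by (rule conn_path)
    moreover have "P ! i \<in> set (butlast P)"
      using nth_mem[of i "butlast P"] b i by (simp add: nth_butlast)
    ultimately have "conn (insert u (set (butlast P)))" using conn_insert sym i by blast
    moreover have "insert u (set (butlast P)) = V - {last P}"
    proof -
      have "distinct (butlast P @ [last P])" "set P = set (butlast P @ [last P])" using dP(2) P by metis+
      then show ?thesis using SP uV up by auto
    qed
    ultimately show "conn (V - {last P})" by simp
    show "3 \<le> card (nonnbs V (last P))"
      by (rule three_le_card[of _ u "hd P" "P ! (i - 1)"]) (use V l in \<open>auto simp: nonnbs_finite\<close>)
  qed (use dP ne in auto)
  have "\<exists>K a1 a2 a3. net V K a1 a2 a3 u (hd P) (last P)"
  proof (rule net_if_three_pendants[OF V(1,2) c V(4)])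
    show "{u, hd P, last P} \<subseteq> V" using dP ne uV by auto
    show "distinct [u, hd P, last P]" using l by auto
    show "\<not> E u (hd P)" "\<not> E u (last P)" "\<not> E (hd P) (last P)" using l by (auto simp: nonnbs_def)
    show "card {w \<in> V. E v w} \<le> 1" if "v \<in> {u, hd P, last P}" for v
    proof (rule degree_le_1_if_traceable_remove[OF V irr])
      show "v \<in> V" using that dP ne uV by auto
      show "ham (V - {v})" using that h1 h2 hu by auto
    qed
  qed
  then show ?thesis by blast
qed

subsection \<open>Extensions by one vertex\<close>

lemma netD:
  assumes "net V K a1 a2 a3 b1 b2 b3"
  shows "V = K \<union> {b1, b2, b3}" "{a1, a2, a3} \<subseteq> K" "distinct [a1, a2, a3, b1, b2, b3]"
    "{b1, b2, b3} \<inter> K = {}" "x \<in> K \<Longrightarrow> y \<in> K \<Longrightarrow> x \<noteq> y \<Longrightarrow> E x y"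
    "x \<in> V \<Longrightarrow> E b1 x \<longleftrightarrow> x = a1" "x \<in> V \<Longrightarrow> E b2 x \<longleftrightarrow> x = a2" "x \<in> V \<Longrightarrow> E b3 x \<longleftrightarrow> x = a3"
  using assms unfolding net_def by blast+

lemma net_pendant:
  assumes "net V K a1 a2 a3 b1 b2 b3" "b \<in> {b1, b2, b3}" "E a b" "a \<in> V" "w \<in> V" "w \<noteq> a"
  shows "\<not> E b w"
  using netD(6-8)[OF assms(1)] sym[OF assms(3)] assms(2,4-6) by blast

lemma triangle_netD:
  assumes "triangle_net V a1 a2 a3 b1 c b2 b3"
  shows "V = {a1, a2, a3, b1, c, b2, b3}" "distinct [a1, a2, a3, b1, c, b2, b3]"
    "E a1 a2" "E a1 a3" "E a2 a3" "E a1 b1" "E a1 c" "E b1 c" "E a2 b2" "E a3 b3"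
    "\<forall>x\<in>V. E b1 x \<longrightarrow> x \<in> {a1, c}" "\<forall>x\<in>V. E c x \<longrightarrow> x \<in> {a1, b1}"
    "\<forall>x\<in>V. E b2 x \<longrightarrow> x \<in> {a2}" "\<forall>x\<in>V. E b3 x \<longrightarrow> x \<in> {a3}"
  using assms unfolding triangle_net_def by blast+

lemma triangle_net_nonadj:
  assumes "triangle_net V a1 a2 a3 b1 c b2 b3"
  shows "\<not> E b1 a2" "\<not> E b1 a3" "\<not> E c a2" "\<not> E c a3"
    "\<not> E b2 a1" "\<not> E b2 a3" "\<not> E b2 b1" "\<not> E b2 c"
    "\<not> E b3 a1" "\<not> E b3 a2" "\<not> E b3 b1" "\<not> E b3 c" "\<not> E b3 b2"
proof -
  note t = triangle_netD(11-14)[OF assms, unfolded triangle_netD(1)[OF assms]] and d = triangle_netD(2)[OF assms]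
  show "\<not> E b1 a2" "\<not> E b1 a3" using bspec[OF t(1), of a2] bspec[OF t(1), of a3] d by auto
  show "\<not> E c a2" "\<not> E c a3" using bspec[OF t(2), of a2] bspec[OF t(2), of a3] d by auto
  show "\<not> E b2 a1" "\<not> E b2 a3" "\<not> E b2 b1" "\<not> E b2 c"
    using bspec[OF t(3), of a1] bspec[OF t(3), of a3] bspec[OF t(3), of b1] bspec[OF t(3), of c] d by auto
  show "\<not> E b3 a1" "\<not> E b3 a2" "\<not> E b3 b1" "\<not> E b3 c" "\<not> E b3 b2"
    using bspec[OF t(4), of a1] bspec[OF t(4), of a2] bspec[OF t(4), of b1] bspec[OF t(4), of c]
      bspec[OF t(4), of b2] d by auto
qed

lemma finite_net: "net V K a1 a2 a3 b1 b2 b3 \<Longrightarrow> finite V \<Longrightarrow> finite K"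
  by (auto simp: net_def)

text \<open>Leaves room for at most four nonneighbours of one further vertex:
  \<open>6 * card V - 18 + 2 * 4\<close> is within the bound \<open>6 * (card V + 1) - 15\<close>,
  five would exceed it.\<close>

lemma nonedges_net:
  assumes n: "net V K a1 a2 a3 b1 b2 b3" and V: "finite V"
  shows "6 * card V \<le> nonedges V + 18"
proof -
  have fK: "finite K" using finite_net[OF n V] .
  note D = netD(1-4)[OF n] and N = netD(6-8)[OF n]
  have VK: "V = insert b1 (insert b2 (insert b3 K))" using D(1) by auto
  have bK: "b1 \<notin> insert b2 (insert b3 K)" "b2 \<notin> insert b3 K" "b3 \<notin> K" using D(3,4) by auto
  have sub: "insert b2 (insert b3 K) \<subseteq> V" "insert b3 K \<subseteq> V" "K \<subseteq> V" using VK by auto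
  have "nonedges (insert b3 K) + 2 * card {a3} \<ge> nonedges K + 2 * card K"
    by (rule nonedges_insert_pendant) (use fK bK N sub in auto)
  moreover have "nonedges (insert b2 (insert b3 K)) + 2 * card {a2} \<ge> nonedges (insert b3 K) + 2 * card (insert b3 K)"
    by (rule nonedges_insert_pendant) (use fK bK N sub in auto)
  moreover have "nonedges V + 2 * card {a1} \<ge> nonedges (insert b2 (insert b3 K)) + 2 * card (insert b2 (insert b3 K))"
    unfolding VK by (rule nonedges_insert_pendant) (use fK bK N sub in auto)
  moreover have "card (insert b3 K) = card K + 1" "card (insert b2 (insert b3 K)) = card K + 2"
    "card V = card K + 3"
    using fK bK VK by auto
  ultimately show ?thesis by simp
qed

text \<open>The bound is 6 * 7 - 15 = 27 here, so this graph is not excluded by counting. On eight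
  vertices it is 33, so a further vertex has at most three nonneighbours.\<close>

lemma nonedges_triangle_net:
  assumes t: "triangle_net V a1 a2 a3 b1 c b2 b3"
  shows "26 \<le> nonedges V" "card V = 7"
proof -
  have d: "distinct [b1, c, b2, b3, a1, a2, a3]" using triangle_netD(2)[OF t] by auto
  have V: "V = insert b3 (insert b2 (insert c (insert b1 {a1, a2, a3})))" using triangle_netD(1)[OF t] by auto
  note N = triangle_net_nonadj[OF t]
  have "V = set [b1, c, b2, b3, a1, a2, a3]" unfolding V by auto
  then show "card V = 7" using distinct_card[OF d] by simp
  have "nonedges (insert b1 {a1, a2, a3}) + 2 * card {a1} \<ge> nonedges {a1, a2, a3} + 2 * card {a1, a2, a3}"
    by (rule nonedges_insert_pendant) (use d N in auto)
  moreover have "nonedges (insert c (insert b1 {a1, a2, a3})) + 2 * card {a1, b1}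
      \<ge> nonedges (insert b1 {a1, a2, a3}) + 2 * card (insert b1 {a1, a2, a3})"
    by (rule nonedges_insert_pendant) (use d N in auto)
  moreover have "nonedges (insert b2 (insert c (insert b1 {a1, a2, a3}))) + 2 * card {a2}
      \<ge> nonedges (insert c (insert b1 {a1, a2, a3})) + 2 * card (insert c (insert b1 {a1, a2, a3}))"
    by (rule nonedges_insert_pendant) (use d N in auto)
  moreover have "nonedges V + 2 * card {a3}
      \<ge> nonedges (insert b2 (insert c (insert b1 {a1, a2, a3})))
        + 2 * card (insert b2 (insert c (insert b1 {a1, a2, a3})))"
    unfolding V by (rule nonedges_insert_pendant) (use d N in auto)
  moreover have "card {a1, a2, a3} = 3" "card (insert b1 {a1, a2, a3}) = 4"
      "card (insert c (insert b1 {a1, a2, a3})) = 5" "card (insert b2 (insert c (insert b1 {a1, a2, a3}))) = 6"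
      "card {a1, b1} = 2"
    using distinct_card[of "[a1, a2, a3]"] distinct_card[of "[b1, a1, a2, a3]"]
      distinct_card[of "[c, b1, a1, a2, a3]"] distinct_card[of "[b2, c, b1, a1, a2, a3]"]
      distinct_card[of "[a1, b1]"] d by auto
  ultimately show "26 \<le> nonedges V" by simp
qed

lemma clique_path:
  assumes "\<And>x y. x \<in> K \<Longrightarrow> y \<in> K \<Longrightarrow> x \<noteq> y \<Longrightarrow> E x y" "set xs \<subseteq> K" "distinct xs"
  shows "successively E xs"
  using assms(2,3)
proof (induction xs)
  case (Cons x xs)
  then have "E x (hd xs)" if "xs \<noteq> []" using that assms(1)[of x "hd xs"] by (cases xs) auto
  with Cons show ?case by (auto simp: successively_Cons)
qed simp

lemma net_swap:
  assumes "net V K a1 a2 a3 b1 b2 b3"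
  shows "net V K a2 a1 a3 b2 b1 b3" "net V K a3 a2 a1 b3 b2 b1"
  using assms unfolding net_def by (simp_all add: insert_commute) auto

text \<open>Hamilton paths and claws exclude every adjacency from \<open>v\<close> to
  \<open>a2\<close>, \<open>a3\<close>, \<open>b2\<close> and \<open>b3\<close>. These exhaust the
  allowed nonneighbours, so \<open>v\<close> sees all the rest; a fourth clique vertex then gives a
  Hamilton path again.\<close>

lemma triangle_net_if_extend_at_pendant:
  assumes n: "net V K a1 a2 a3 b1 b2 b3" and V: "finite V" "v \<notin> V"
    and cf: "clawfree (insert v V)" and nh: "\<not> ham (insert v V)" and nn: "card (nonnbs V v) \<le> 4"
    and vb: "E v b1"
  shows "triangle_net (insert v V) a1 a2 a3 b1 v b2 b3"
proof -
  have fK: "finite K" using finite_net[OF n V(1)] .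
  note D = netD(1-4)[OF n]
  have d: "distinct [a1, a2, a3, b1, b2, b3]" "v \<notin> K" "b1 \<notin> K" "b2 \<notin> K" "b3 \<notin> K"
    "v \<noteq> b1" "v \<noteq> b2" "v \<noteq> b3" using D V(2) by auto
  have aK: "a1 \<in> K" "a2 \<in> K" "a3 \<in> K" using D by auto
  have VK: "V = insert b1 (insert b2 (insert b3 K))" using D(1) by auto
  have "a1 \<in> V" "a2 \<in> V" "a3 \<in> V" using aK VK by auto
  then have ab: "E a1 b1" "E a2 b2" "E a3 b3" "E b1 a1" "E b2 a2" "E b3 a3"
    using netD(6-8)[OF n] sym by simp_all
  note cl = netD(5)[OF n]
  note ab = ab sym[OF vb]
  \<comment> \<open>The other clique vertices; the explicit paths collect them on the way from
    \<open>a3\<close> or \<open>a2\<close> to \<open>a1\<close>.\<close>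
  obtain ks where ks: "set ks = K - {a1, a2, a3}" "distinct ks"
    using finite_distinct_list[of "K - {a1, a2, a3}"] fK by auto
  have K: "K = insert a1 (insert a2 (insert a3 (set ks)))" using ks aK by auto
  have k: "successively E ((a3 # ks) @ [a1])" "successively E ((a2 # ks) @ [a1])"
    using ks aK d by (intro clique_path[OF cl]; auto)+
  have dl: "distinct ([v, b1, b2, b3, a1, a2, a3] @ ks)" using d ks aK by auto
  have V': "insert v V = set ([v, b1, b2, b3, a1, a2, a3] @ ks)" unfolding VK K by auto
  have no2: "\<not> E v b2"
  proof
    assume *: "E v b2"
    show False
    proof (rule notE[OF nh], rule hamI)
      show "set (b3 # ((a3 # ks) @ [a1]) @ [b1, v, b2, a2]) = insert v V" unfolding V' by auto
      show "distinct (b3 # ((a3 # ks) @ [a1]) @ [b1, v, b2, a2])" using dl by auto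
      show "successively E (b3 # ((a3 # ks) @ [a1]) @ [b1, v, b2, a2])"
        using * ab k by (auto simp: successively_append_iff successively_Cons hd_append split: if_splits)
    qed
  qed
  have no3: "\<not> E v b3"
  proof
    assume *: "E v b3"
    show False
    proof (rule notE[OF nh], rule hamI)
      show "set (b2 # ((a2 # ks) @ [a1]) @ [b1, v, b3, a3]) = insert v V" unfolding V' by auto
      show "distinct (b2 # ((a2 # ks) @ [a1]) @ [b1, v, b3, a3])" using dl by auto
      show "successively E (b2 # ((a2 # ks) @ [a1]) @ [b1, v, b3, a3])"
        using * ab k by (auto simp: successively_append_iff successively_Cons hd_append split: if_splits)
    qed
  qed
  \<comment> \<open>At the clique end \<open>a\<close> of a pendant edge, \<open>b\<close>,
    \<open>v\<close> and \<open>w\<close> would be the leaves of a claw unless \<open>v\<close> is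
    adjacent to \<open>w\<close>.\<close>
  have claw: "E v w" if h: "E a b" "a \<in> K" "b \<in> {b2, b3}" "E v a" "w \<in> K" "w \<noteq> a" for a b w
  proof -
    have "E a b" "E a v" "E a w" using h(1,2,4,5,6) sym[of v a] cl[of a w] by auto
    moreover have V': "{a, b, v, w} \<subseteq> insert v V" using h(2,3,5) VK by auto
    moreover have "\<not> E b w"
      by (rule net_pendant[OF n _ h(1)]) (use h(2,3,5,6) VK in auto)
    moreover have "\<not> E b v" using h(3) no2 no3 sym[of b v] by auto
    moreover have "b \<noteq> v" "b \<noteq> w" "v \<noteq> w" using h d by auto
    ultimately show ?thesis using clawfreeD[OF cf, of a b v w] by auto
  qed
  have noa2: "\<not> E v a2"
  proof
    assume "E v a2"
    from claw[OF ab(2) aK(2) _ this aK(3)] d have *: "E v a3" by auto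
    show False
    proof (rule notE[OF nh], rule hamI)
      show "set (b2 # ((a2 # ks) @ [a1]) @ [b1, v, a3, b3]) = insert v V" unfolding V' by auto
      show "distinct (b2 # ((a2 # ks) @ [a1]) @ [b1, v, a3, b3])" using dl by auto
      show "successively E (b2 # ((a2 # ks) @ [a1]) @ [b1, v, a3, b3])"
        using * ab k by (auto simp: successively_append_iff successively_Cons hd_append split: if_splits)
    qed
  qed
  have noa3: "\<not> E v a3"
  proof
    assume "E v a3"
    from claw[OF ab(3) aK(3) _ this aK(2)] d have "E v a2" by auto
    with noa2 show False by simp
  qed
  have all: "E v w" if w: "w \<in> V" "w \<notin> {a2, a3, b2, b3}" for w
  proof (rule ccontr)
    assume "\<not> E v w"
    then have "length [w, a2, a3, b2, b3] \<le> card (nonnbs V v)"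
      using w d no2 no3 noa2 noa3 aK VK V
      by (intro length_le_card) (auto simp: nonnbs_def)
    with nn show False by simp
  qed
  have "ks = []"
  proof (rule ccontr)
    assume "ks \<noteq> []"
    then obtain w ws where w: "ks = w # ws" by (cases ks) auto
    have wK: "w \<in> K" "w \<notin> {a1, a2, a3}" using w ks by auto
    then have "E v w" "E w a3" using all[of w] cl[of w a3] aK VK d by auto
    note * = this
    have k: "successively E ((a2 # ws) @ [a1])"
      using ks w aK d by (intro clique_path[OF cl]) auto
    have w': "w \<noteq> a1" "w \<noteq> a2" "w \<noteq> a3" "w \<notin> set ws" "distinct ws" "w \<notin> {v, b1, b2, b3}"
      "set ws \<subseteq> K - {a1, a2, a3}"
      using wK ks w d by auto
    show False
    proof (rule notE[OF nh], rule hamI)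
      show "set (b2 # ((a2 # ws) @ [a1]) @ [b1, v, w, a3, b3]) = insert v V" unfolding V' w by auto
      show "distinct (b2 # ((a2 # ws) @ [a1]) @ [b1, v, w, a3, b3])" using dl w w' by auto
      show "successively E (b2 # ((a2 # ws) @ [a1]) @ [b1, v, w, a3, b3])"
        using * ab k by (auto simp: successively_append_iff successively_Cons hd_append split: if_splits)
    qed
  qed
  then have K3: "K = {a1, a2, a3}" using K by simp
  have va: "E v a1" using all[of a1] aK VK d by auto
  have V7: "insert v V = {a1, a2, a3, b1, v, b2, b3}" unfolding VK K3 by auto
  show ?thesis
    unfolding triangle_net_def
  proof (intro conjI)
    show "\<forall>x\<in>insert v V. E b1 x \<longrightarrow> x \<in> {a1, v}" "\<forall>x\<in>insert v V. E b2 x \<longrightarrow> x \<in> {a2}"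
      "\<forall>x\<in>insert v V. E b3 x \<longrightarrow> x \<in> {a3}"
      using netD(6-8)[OF n] no2[THEN nonadj_sym] no3[THEN nonadj_sym] by auto
    show "\<forall>x\<in>insert v V. E v x \<longrightarrow> x \<in> {a1, b1}"
      unfolding V7 using no2 no3 noa2 noa3 irrefl by auto
    show "insert v V = {a1, a2, a3, b1, v, b2, b3}" by (fact V7)
    show "distinct [a1, a2, a3, b1, v, b2, b3]" using d aK by auto
    show "E a1 a2" "E a1 a3" "E a2 a3" using cl aK d by auto
    show "E a1 b1" "E a2 b2" "E a3 b3" "E b1 v" "E a1 v" using ab sym[OF va] by auto
  qed
qed

text \<open>The pendant vertices are three of at most four nonneighbours, so \<open>v\<close> misses
  at most one clique vertex, and claws exclude that.\<close>

lemma net_extend_at_clique: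
  assumes n: "net V K a1 a2 a3 b1 b2 b3" and V: "finite V" "v \<notin> V"
    and cf: "clawfree (insert v V)" and nn: "card (nonnbs V v) \<le> 4"
    and vb: "\<not> E v b1" "\<not> E v b2" "\<not> E v b3"
  shows "net (insert v V) (insert v K) a1 a2 a3 b1 b2 b3"
proof -
  note D = netD(1-4)[OF n]
  have d: "distinct [a1, a2, a3, b1, b2, b3]" "v \<notin> K" "b1 \<notin> K" "b2 \<notin> K" "b3 \<notin> K"
    "v \<noteq> b1" "v \<noteq> b2" "v \<noteq> b3" using D V(2) by auto
  have aK: "a1 \<in> K" "a2 \<in> K" "a3 \<in> K" using D by auto
  have VK: "V = insert b1 (insert b2 (insert b3 K))" using D(1) by auto
  have "a1 \<in> V" "a2 \<in> V" "a3 \<in> V" using aK VK by auto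
  then have ab: "E a1 b1" "E a2 b2" "E a3 b3" "E b1 a1" "E b2 a2" "E b3 a3"
    using netD(6-8)[OF n] sym by simp_all
  note cl = netD(5)[OF n]
  have all: "E v w" if w: "w \<in> K" for w
  proof (rule ccontr)
    assume vw: "\<not> E v w"
    have one: "E v x" if "x \<in> K" "x \<noteq> w" for x
    proof (rule ccontr)
      assume "\<not> E v x"
      then have "length [w, x, b1, b2, b3] \<le> card (nonnbs V v)"
        using w that d vb vw VK V
        by (intro length_le_card) (auto simp: nonnbs_def)
      with nn show False by simp
    qed
    have step: False if h: "E a b" "a \<in> K" "b \<in> {b1, b2, b3}" "a \<noteq> w" for a b
    proof -
      have "E a b" "E a v" "E a w" using h(1,2,4) sym[OF one[of a]] cl[of a w] w by auto
      moreover have "{a, b, v, w} \<subseteq> insert v V" using h(2,3) VK w by auto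
      moreover have "\<not> E b w"
        by (rule net_pendant[OF n _ h(1)]) (use h(2,3,4) w VK in auto)
      moreover have "\<not> E b v" using h(3) vb sym[of b v] by auto
      moreover have "b \<noteq> v" "b \<noteq> w" "v \<noteq> w" using h(3) d w by auto
      ultimately show ?thesis using clawfreeD[OF cf, of a b v w] vw by auto
    qed
    \<comment> \<open>The vertex \<open>w\<close> differs from \<open>a1\<close> or from
      \<open>a2\<close>, and that one is the centre of the claw.\<close>
    show False using step[OF ab(1) aK(1)] step[OF ab(2) aK(2)] d by auto
  qed
  show ?thesis unfolding net_def
  proof (intro conjI)
    show "\<forall>x\<in>insert v K. \<forall>y\<in>insert v K. x \<noteq> y \<longrightarrow> E x y" using cl all all[THEN sym] by blast
    have "\<not> E b1 v" "\<not> E b2 v" "\<not> E b3 v" "v \<notin> {a1, a2, a3}" using vb[THEN nonadj_sym] aK d by auto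
    then show "\<forall>x\<in>insert v V. E b1 x \<longleftrightarrow> x = a1" "\<forall>x\<in>insert v V. E b2 x \<longleftrightarrow> x = a2"
      "\<forall>x\<in>insert v V. E b3 x \<longleftrightarrow> x = a3" using netD(6-8)[OF n] by auto
  qed (use D d in auto)
qed

text \<open>By \<open>net_swap\<close> a pendant vertex adjacent to \<open>v\<close> may be taken to
  be \<open>b1\<close>.\<close>

lemma net_extend:
  assumes n: "net V K a1 a2 a3 b1 b2 b3" and V: "finite V" "v \<notin> V"
    and cf: "clawfree (insert v V)" and nh: "\<not> ham (insert v V)" and nn: "card (nonnbs V v) \<le> 4"
  shows "(\<exists>K a1 a2 a3 b1 b2 b3. net (insert v V) K a1 a2 a3 b1 b2 b3)
    \<or> (\<exists>a1 a2 a3 b1 c b2 b3. triangle_net (insert v V) a1 a2 a3 b1 c b2 b3)"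
proof -
  have "\<exists>a1 a2 a3 b1 c b2 b3. triangle_net (insert v V) a1 a2 a3 b1 c b2 b3" if "E v b1 \<or> E v b2 \<or> E v b3"
    using that triangle_net_if_extend_at_pendant[OF n V cf nh nn] triangle_net_if_extend_at_pendant[OF net_swap(1)[OF n] V cf nh nn]
      triangle_net_if_extend_at_pendant[OF net_swap(2)[OF n] V cf nh nn] by blast
  then show ?thesis using net_extend_at_clique[OF n V cf nn] by blast
qed

text \<open>At most three nonneighbours leave \<open>v\<close> enough adjacencies for a Hamilton
  path on eight vertices in every case.\<close>

lemma triangle_net_not_extendable:
  assumes t: "triangle_net V a1 a2 a3 b1 c b2 b3" and v: "v \<notin> V"
    and cf: "clawfree (insert v V)" and nn: "card (nonnbs V v) \<le> 3"
  shows "ham (insert v V)"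
proof (rule ccontr)
  assume nh: "\<not> ham (insert v V)"
  note V = triangle_netD(1)[OF t]
  have d: "distinct [v, a1, a2, a3, b1, c, b2, b3]" using triangle_netD(2)[OF t] v unfolding V by auto
  note e = triangle_netD(3-10)[OF t] triangle_netD(3-10)[OF t, THEN sym]
  have nhP: False if "set P = insert v V" "distinct P" "successively E P" for P
    using nh hamI[OF that] by blast
  have four: "card A \<le> 3 \<Longrightarrow> finite A \<Longrightarrow> \<not> (set [w, x, y, z] \<subseteq> A \<and> distinct [w, x, y, z])"
    for A and w x y z :: 'a
    using length_le_card[of A "[w, x, y, z]"] by auto
  have fn: "finite (nonnbs V v)" using V by (simp add: nonnbs_finite)
  note nn4 = four[OF nn fn]
  have vs: "E v x \<longleftrightarrow> E x v" for x using sym by blast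
  have P1: False if "E v b2" "E v b3"
    by (rule nhP[of "[c, b1, a1, a2, b2, v, b3, a3]"]) (use d e that that[THEN sym] in \<open>auto simp: V\<close>)
  have P2: False if "E v b1" "E v b2"
    by (rule nhP[of "[c, b1, v, b2, a2, a1, a3, b3]"]) (use d e that that[THEN sym] in \<open>auto simp: V\<close>)
  have P3: False if "E v c" "E v b2"
    by (rule nhP[of "[b1, c, v, b2, a2, a1, a3, b3]"]) (use d e that that[THEN sym] in \<open>auto simp: V\<close>)
  have P4: False if "E v b1" "E v b3"
    by (rule nhP[of "[c, b1, v, b3, a3, a1, a2, b2]"]) (use d e that that[THEN sym] in \<open>auto simp: V\<close>)
  have P5: False if "E v c" "E v b3"
    by (rule nhP[of "[b1, c, v, b3, a3, a1, a2, b2]"]) (use d e that that[THEN sym] in \<open>auto simp: V\<close>)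
  \<comment> \<open>Given \<open>E v b2\<close>, the paths \<open>P1\<close> to \<open>P3\<close>
    make \<open>b3\<close>, \<open>b1\<close> and \<open>c\<close> the three nonneighbours, which
    forces \<open>E v a3\<close> and one more Hamilton path.\<close>
  have nb2: "\<not> E v b2"
  proof
    assume *: "E v b2"
    then have "E v a3" using nn4[of b3 b1 c a3] P1 P2 P3 d V by (auto simp: nonnbs_def)
    note this * this[THEN sym] *[THEN sym]
    then show False
      by (intro nhP[of "[c, b1, a1, a2, b2, v, a3, b3]"]) (use d e in \<open>auto simp: V\<close>)
  qed
  have nb3: "\<not> E v b3"
  proof
    assume *: "E v b3"
    then have "E v a2" using nn4[of b2 b1 c a2] P1 P4 P5 d V by (auto simp: nonnbs_def)
    note this * this[THEN sym] *[THEN sym]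
    then show False
      by (intro nhP[of "[c, b1, a1, a3, b3, v, a2, b2]"]) (use d e in \<open>auto simp: V\<close>)
  qed
  \<comment> \<open>With \<open>v\<close> adjacent to neither \<open>b2\<close> nor
    \<open>b3\<close>, claws at \<open>a2\<close> and \<open>a3\<close> spread an adjacency of
    \<open>v\<close> to one of them over the whole triangle \<open>a1\<close>, \<open>a2\<close>,
    \<open>a3\<close>.\<close>
  have claw: "E v w" if h: "a = a2 \<and> b = b2 \<or> a = a3 \<and> b = b3" "E v a" "E a w" "w \<in> V" "w \<noteq> b" for a b w
  proof -
    have "E a b" "E a v" "E a w" using h e vs by auto
    moreover have "{a, b, v, w} \<subseteq> insert v V" using h V by auto
    moreover have "w \<noteq> a" using h(3) irrefl by auto
    then have "\<not> E b w" using h(1,4) triangle_netD(13,14)[OF t] by blast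
    moreover have "\<not> E b v" using h(1) nb2[THEN nonadj_sym] nb3[THEN nonadj_sym] by blast
    moreover have "b \<noteq> v" "b \<noteq> w" "v \<noteq> w" using h d V by auto
    ultimately show ?thesis using clawfreeD[OF cf, of a b v w] by auto
  qed
  have "E v a2 \<or> E v a3" using nn4[of b2 b3 a2 a3] nb2 nb3 d V by (auto simp: nonnbs_def)
  moreover have "E v a3 \<and> E v a1" if "E v a2"
    using claw[of a2 b2 a3] claw[of a2 b2 a1] that e(9,11) e(3) d by (simp add: V)
  moreover have "E v a2 \<and> E v a1" if "E v a3"
    using claw[of a3 b3 a2] claw[of a3 b3 a1] that e(10,11) d by (simp add: V)
  ultimately have a23: "E v a2" "E v a3" "E v a1" by blast+
  have "E v b1 \<or> E v c" using nn4[of b2 b3 b1 c] nb2 nb3 d V by (auto simp: nonnbs_def)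
  then show False
  proof
    assume *: "E v b1"
    show False
      by (rule nhP[of "[b2, a2, a1, c, b1, v, a3, b3]"]) (use d e a23 sym[OF *] in \<open>auto simp: V\<close>)
  next
    assume *: "E v c"
    show False
      by (rule nhP[of "[b2, a2, a1, b1, c, v, a3, b3]"]) (use d e a23 sym[OF *] in \<open>auto simp: V\<close>)
  qed
qed

section \<open>Dense nontraceable graphs, by induction\<close>

text \<open>Deleting a vertex with at least three nonneighbours lowers \<open>nonedges\<close> by at
  least 6 and \<open>6 * card V\<close> by exactly 6, so the density hypothesis is
  inherited.\<close>

theorem nontraceable_dense:
  assumes "finite V" "conn V" "clawfree V" "\<not> ham V" "nonedges V + 15 \<le> 6 * card V"
  shows "(\<exists>K a1 a2 a3 b1 b2 b3. net V K a1 a2 a3 b1 b2 b3)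
    \<or> (\<exists>a1 a2 a3 b1 c b2 b3. triangle_net V a1 a2 a3 b1 c b2 b3)"
  using assms
proof (induction "card V" arbitrary: V)
  case 0
  then show ?case by (auto simp: conn_def)
next
  case (Suc n)
  show ?case
  proof (cases "\<forall>v\<in>V. conn (V - {v}) \<longrightarrow> 3 \<le> card (nonnbs V v) \<longrightarrow> ham (V - {v})")
    case True
    then show ?thesis using net_if_irreducible[OF Suc.prems(1,3,4,5,2)] by blast
  next
    case False
    then obtain v where v: "v \<in> V" "conn (V - {v})" "3 \<le> card (nonnbs V v)" "\<not> ham (V - {v})" by blast
    define W where "W = V - {v}"
    have W: "finite W" "v \<notin> W" "insert v W = V" "card V = Suc (card W)" "clawfree W" "conn W" "\<not> ham W"
      using Suc.prems v clawfree_subset[of V W] unfolding W_def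
      by (auto simp: card.remove simp del: card_Diff_insert)
    have nW: "nonnbs V v = nonnbs W v" by (auto simp: nonnbs_def W_def)
    have N: "nonedges V = nonedges W + 2 * card (nonnbs W v)"
      using nonedges_insert[OF W(1,2)] W(3) by simp
    have "nonedges W + 15 \<le> 6 * card W" using N Suc.prems(5) v(3) W(4) nW by simp
    then consider K a1 a2 a3 b1 b2 b3 where "net W K a1 a2 a3 b1 b2 b3"
      | a1 a2 a3 b1 c b2 b3 where "triangle_net W a1 a2 a3 b1 c b2 b3"
      using Suc.hyps(1)[of W] Suc.hyps(2) W by auto
    then show ?thesis
    proof cases
      case 1
      then have "card (nonnbs W v) \<le> 4" using nonedges_net[OF 1 W(1)] N Suc.prems(5) W(4) by simp
      with net_extend[OF 1 W(1,2)] Suc.prems W(3) show ?thesis by simp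
    next
      case 2
      then have "card (nonnbs W v) \<le> 3" using nonedges_triangle_net[OF 2] N Suc.prems(5) W(4) by simp
      with triangle_net_not_extendable[OF 2 W(2)] Suc.prems W(3) show ?thesis by simp
    qed
  qed
qed

subsection \<open>Eigenvalue bounds\<close>

lemma sum_degrees:
  assumes "finite V"
  shows "(\<Sum>v\<in>V. card {w \<in> V. E v w}) + nonedges V + card V = card V * card V"
proof -
  have "(\<Sum>v\<in>V. card {w \<in> V. E v w}) + (\<Sum>v\<in>V. card (nonnbs V v)) + (\<Sum>v\<in>V. 1)
      = (\<Sum>v\<in>V. card {w \<in> V. E v w} + card (nonnbs V v) + 1)"
    by (simp only: sum.distrib)
  also have "\<dots> = (\<Sum>v\<in>V. card V)" using assms card_nbs by (intro sum.cong) auto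
  finally show ?thesis by (simp add: nonedges_def)
qed

lemma sum_square_le_card_mult: "finite A \<Longrightarrow> (\<Sum>i\<in>A. g i)\<^sup>2 \<le> real (card A) * (\<Sum>i\<in>A. (g i)\<^sup>2)" for g :: "'b \<Rightarrow> real"
  using sum_squared_le_sum_of_squares[of g A] by (simp add: mult.commute)

text \<open>Hong's bound \<open>\<mu>\<^sup>2 \<le> 2m - n + 1\<close>.\<close>

lemma eigenvalue_bound_edges:
  fixes f :: "'a \<Rightarrow> complex"
  assumes V: "finite V" and deg: "\<And>v. v \<in> V \<Longrightarrow> \<exists>w\<in>V. E v w"
    and eig: "\<And>v. v \<in> V \<Longrightarrow> (\<Sum>w\<in>{w \<in> V. E v w}. f w) = l * f v"
    and nz: "v0 \<in> V" "f v0 \<noteq> 0"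
  shows "(cmod l)\<^sup>2 \<le> real (\<Sum>v\<in>V. card {w \<in> V. E v w}) - real (card V) + 1"
proof -
  define N where "N v = {w \<in> V. E v w}" for v
  define a where "a v = (cmod (f v))\<^sup>2" for v
  define A where "A = sum a V"
  have fN: "finite (N v)" "finite (nonnbs V v)" for v using V by (auto simp: N_def nonnbs_finite)
  have a0: "0 \<le> a v" for v by (simp add: a_def)
  have "0 < a v0" using nz by (simp add: a_def)
  then have A0: "0 < A" unfolding A_def using V nz a0 by (intro sum_pos2[of V v0]) auto
  have dN: "real (card (N v)) + real (card (nonnbs V v)) = real (card V) - 1" if "v \<in> V" for v
    using card_nbs[OF V that] unfolding N_def by linarith
  have split: "(\<Sum>w\<in>N v. a w) = A - a v - (\<Sum>w\<in>nonnbs V v. a w)" if "v \<in> V" for v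
  proof -
    have "V = insert v (N v \<union> nonnbs V v)" using that irrefl by (auto simp: N_def nonnbs_def)
    moreover have "v \<notin> N v \<union> nonnbs V v" "N v \<inter> nonnbs V v = {}"
      using irrefl by (auto simp: N_def nonnbs_def)
    ultimately have "A = a v + ((\<Sum>w\<in>N v. a w) + (\<Sum>w\<in>nonnbs V v. a w))"
      unfolding A_def using fN by (metis finite_UnI sum.insert sum.union_disjoint)
    then show ?thesis by simp
  qed
  have step: "(cmod l)\<^sup>2 * a v \<le> card (N v) * A - card (N v) * a v - (\<Sum>w\<in>nonnbs V v. a w)" if v: "v \<in> V" for v
  proof -
    have "(cmod l)\<^sup>2 * a v = (cmod (\<Sum>w\<in>N v. f w))\<^sup>2"
      using eig[OF v] by (simp add: a_def N_def norm_mult power_mult_distrib)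
    also have "\<dots> \<le> (\<Sum>w\<in>N v. cmod (f w))\<^sup>2" by (intro power_mono norm_sum) simp
    also have "\<dots> \<le> card (N v) * (\<Sum>w\<in>N v. a w)" unfolding a_def by (rule sum_square_le_card_mult) (rule fN)
    also have "\<dots> = card (N v) * A - card (N v) * a v - card (N v) * (\<Sum>w\<in>nonnbs V v. a w)"
      unfolding split[OF v] by (simp add: algebra_simps)
    finally have "(cmod l)\<^sup>2 * a v
      \<le> card (N v) * A - card (N v) * a v - card (N v) * (\<Sum>w\<in>nonnbs V v. a w)" .
    \<comment> \<open>As all degrees are at least 1, the coefficient \<open>card (N v)\<close> can
      be lowered to 1, which prepares the exchange of summation in \<open>swap\<close>.\<close>
    moreover have "1 * (\<Sum>w\<in>nonnbs V v. a w) \<le> card (N v) * (\<Sum>w\<in>nonnbs V v. a w)"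
    proof (rule mult_right_mono)
      have "N v \<noteq> {}" using deg[OF v] by (auto simp: N_def)
      then show "1 \<le> real (card (N v))" using fN(1)[of v] by (simp add: Suc_le_eq card_gt_0_iff)
    qed (simp add: sum_nonneg a0)
    ultimately show ?thesis by simp
  qed
  have swap: "(\<Sum>v\<in>V. \<Sum>w\<in>nonnbs V v. a w) = (\<Sum>w\<in>V. card (nonnbs V w) * a w)"
  proof -
    have "(\<Sum>v\<in>V. \<Sum>w\<in>nonnbs V v. a w) = (\<Sum>v\<in>V. \<Sum>w\<in>V. if w \<noteq> v \<and> \<not> E v w then a w else 0)"
      unfolding nonnbs_def using V by (simp add: sum.inter_filter)
    also have "\<dots> = (\<Sum>w\<in>V. \<Sum>v\<in>V. if w \<noteq> v \<and> \<not> E v w then a w else 0)" by (rule sum.swap)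
    also have "\<dots> = (\<Sum>w\<in>V. \<Sum>v\<in>V. if v \<noteq> w \<and> \<not> E w v then a w else 0)"
      by (intro sum.cong refl if_cong) (simp_all add: sym_iff eq_commute)
    also have "\<dots> = (\<Sum>w\<in>V. \<Sum>v\<in>nonnbs V w. a w)"
      unfolding nonnbs_def by (intro sum.cong refl sum.inter_filter[symmetric] V)
    also have "\<dots> = (\<Sum>w\<in>V. card (nonnbs V w) * a w)" by simp
    finally show ?thesis .
  qed
  have "(cmod l)\<^sup>2 * A = (\<Sum>v\<in>V. (cmod l)\<^sup>2 * a v)" by (simp add: A_def sum_distrib_left)
  also have "\<dots> \<le> (\<Sum>v\<in>V. card (N v) * A - card (N v) * a v - (\<Sum>w\<in>nonnbs V v. a w))"
    by (intro sum_mono step)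
  \<comment> \<open>After the exchange \<open>a v\<close> is subtracted with coefficient degree plus
    number of nonneighbours, which is \<open>card V - 1\<close> for every \<open>v\<close>.\<close>
  also have "\<dots> = (\<Sum>v\<in>V. real (card (N v))) * A - (\<Sum>v\<in>V. (real (card (N v)) + real (card (nonnbs V v))) * a v)"
    by (simp add: sum_subtractf swap sum.distrib distrib_right sum_distrib_right)
  also have "(\<Sum>v\<in>V. (real (card (N v)) + real (card (nonnbs V v))) * a v) = (\<Sum>v\<in>V. (real (card V) - 1) * a v)"
    by (intro sum.cong refl) (simp add: dN)
  also have "\<dots> = (real (card V) - 1) * A" by (simp add: A_def sum_distrib_left)
  finally have "(cmod l)\<^sup>2 * A \<le> (real (\<Sum>v\<in>V. card (N v)) - real (card V) + 1) * A"
    by (simp add: algebra_simps)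
  then show ?thesis using A0 unfolding N_def by (simp add: mult_le_cancel_right)
qed

text \<open>A Collatz-Wielandt bound: compare the eigenfunction with the positive weights
  \<open>x\<close> at a vertex where \<open>cmod (f v) / x v\<close> is largest.\<close>

lemma eigenvalue_less_weights:
  fixes f :: "'a \<Rightarrow> complex" and x :: "'a \<Rightarrow> real"
  assumes V: "finite V" and pos: "\<And>v. v \<in> V \<Longrightarrow> 0 < x v"
    and less: "\<And>v. v \<in> V \<Longrightarrow> (\<Sum>w\<in>{w \<in> V. E v w}. x w) < c * x v"
    and eig: "\<And>v. v \<in> V \<Longrightarrow> (\<Sum>w\<in>{w \<in> V. E v w}. f w) = l * f v"
    and nz: "v0 \<in> V" "f v0 \<noteq> 0"
  shows "cmod l < c"
proof -
  have "finite ((\<lambda>v. cmod (f v) / x v) ` V)" "(\<lambda>v. cmod (f v) / x v) ` V \<noteq> {}" using V nz by auto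
  from Max_in[OF this] obtain v where v: "v \<in> V" "cmod (f v) / x v = Max ((\<lambda>v. cmod (f v) / x v) ` V)"
    by auto
  define r where "r = cmod (f v) / x v"
  have le: "cmod (f w) / x w \<le> r" if "w \<in> V" for w
    unfolding r_def v(2) using V that by (intro Max_ge) auto
  have "0 < cmod (f v0) / x v0" using nz pos by simp
  with le[OF nz(1)] have r: "0 < r" by linarith
  have fv: "cmod (f v) = r * x v" using pos[OF v(1)] by (simp add: r_def)
  have "cmod l * cmod (f v) = cmod (\<Sum>w\<in>{w \<in> V. E v w}. f w)"
    using eig[OF v(1)] by (simp add: norm_mult)
  also have "\<dots> \<le> (\<Sum>w\<in>{w \<in> V. E v w}. cmod (f w))" by (rule norm_sum)
  also have "\<dots> \<le> (\<Sum>w\<in>{w \<in> V. E v w}. r * x w)"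
    using le pos by (intro sum_mono) (auto simp: field_simps)
  also have "\<dots> = r * (\<Sum>w\<in>{w \<in> V. E v w}. x w)" by (simp add: sum_distrib_left)
  also have "\<dots> < r * (c * x v)" using less[OF v(1)] r by simp
  also have "\<dots> = c * cmod (f v)" by (simp add: fv)
  finally show ?thesis using fv r pos[OF v(1)] by simp
qed

text \<open>On seven vertices \<open>n - 4\<close> is 3, so this excludes the triangle net. The
  neighbour sums stay below three times the weights: 26 < 30, 20 < 21, 16 < 18 and 7 < 9.\<close>

lemma triangle_net_eigenvalue_less:
  fixes f :: "'a \<Rightarrow> complex"
  assumes t: "triangle_net V a1 a2 a3 b1 c b2 b3"
    and eig: "\<And>v. v \<in> V \<Longrightarrow> (\<Sum>w\<in>{w \<in> V. E v w}. f w) = l * f v"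
    and nz: "v0 \<in> V" "f v0 \<noteq> 0"
  shows "cmod l < 3"
proof -
  \<comment> \<open>a perturbed Perron vector\<close>
  define x :: "'a \<Rightarrow> real" where
    "x v = (if v = a1 then 10 else if v \<in> {b1, c} then 6 else if v \<in> {a2, a3} then 7 else 3)" for v
  note V = triangle_netD(1)[OF t] and d = triangle_netD(2)[OF t]
  have d': "distinct [a1, a2, a3, b1]" "distinct [a1, a2, a3, b2]" "distinct [a1, a2, a3, b3]"
    "distinct [a1, a2, a3, b1, c]" using d by auto
  have na: "\<not> E u v" if "\<not> E v u" for u v using that sym by blast
  note e = triangle_netD(3-10)[OF t] triangle_netD(3-10)[OF t, THEN sym] triangle_net_nonadj[OF t] triangle_net_nonadj[OF t, THEN na] irrefl
  have nbs: "{w \<in> V. E a1 w} = {a2, a3, b1, c}" "{w \<in> V. E a2 w} = {a1, a3, b2}"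
    "{w \<in> V. E a3 w} = {a1, a2, b3}" "{w \<in> V. E b1 w} = {a1, c}" "{w \<in> V. E c w} = {a1, b1}"
    "{w \<in> V. E b2 w} = {a2}" "{w \<in> V. E b3 w} = {a3}"
    unfolding V by (auto simp: e)
  have vals: "x a1 = 10" "x a2 = 7" "x a3 = 7" "x b1 = 6" "x c = 6" "x b2 = 3" "x b3 = 3"
    using d by (auto simp: x_def)
  show ?thesis
  proof (rule eigenvalue_less_weights[OF _ _ _ eig nz])
    show "finite V" by (simp add: V)
    show "0 < x v" for v by (simp add: x_def)
    show "(\<Sum>w\<in>{w \<in> V. E v w}. x w) < 3 * x v" if "v \<in> V" for v
    proof -
      have "v = a1 \<or> v = a2 \<or> v = a3 \<or> v = b1 \<or> v = c \<or> v = b2 \<or> v = b3" using that V by auto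
      moreover have "sum x {a2, a3, b1, c} = 26" "sum x {a1, a3, b2} = 20" "sum x {a1, a2, b3} = 20"
          "sum x {a1, c} = 16" "sum x {a1, b1} = 16"
        using d by (simp_all add: vals)
      ultimately show ?thesis by (elim disjE) (simp_all add: nbs vals)
    qed
  qed
qed

end

subsection \<open>Graphs as relations\<close>

text \<open>Turns an eigenvector for an eigenvalue of maximal modulus into a function on the
  vertices. Nonemptiness gives the matrix positive dimension, so that its spectral radius is
  attained.\<close>

lemma graph_eigenfunction:
  assumes "finite (verts G)" "verts G \<noteq> {}"
  obtains l and f :: "'a \<Rightarrow> complex" and v0 where "cmod l = graph_spectral_radius G" "v0 \<in> verts G" "f v0 \<noteq> 0"
    "\<And>v. v \<in> verts G \<Longrightarrow> (\<Sum>w\<in>{w \<in> verts G. v \<rightarrow>\<^bsub>G\<^esub> w}. f w) = l * f v"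
proof -
  obtain vs where vs: "set vs = verts G" "distinct vs" using finite_distinct_list[OF assms(1)] by blast
  define n where "n = length vs"
  define A where "A = adjacency_matrix G vs"
  have n: "0 < n" using vs assms by (auto simp: n_def)
  have A: "A \<in> carrier_mat n n" by (simp add: A_def adjacency_matrix_def n_def)
  from spectral_radius_mem_max(1)[OF A n] obtain l where l: "l \<in> spectrum A" "cmod l = spectral_radius A"
    by auto
  then obtain x where x: "x \<in> carrier_vec n" "x \<noteq> 0\<^sub>v n" "A *\<^sub>v x = l \<cdot>\<^sub>v x"
    using A by (auto simp: spectrum_def eigenvalue_def eigenvector_def)
  have b: "bij_betw ((!) vs) {..<n} (verts G)" using vs by (auto simp: n_def intro!: bij_betw_nth)
  define f where "f v = x $ (inv_into {..<n} ((!) vs) v)" for v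
  have fi: "f (vs ! i) = x $ i" if "i < n" for i
    using bij_betw_inv_into_left[OF b] that by (simp add: f_def)
  obtain i where i: "i < n" "x $ i \<noteq> 0" using x by (metis carrier_vecD eq_vecI index_zero_vec)
  show thesis
  proof (rule that[of l "vs ! i" f])
    show "cmod l = graph_spectral_radius G"
      using l(2) graph_spectral_radius_eq[OF vs(2,1)] by (simp add: A_def)
    show "vs ! i \<in> verts G" "f (vs ! i) \<noteq> 0" using i fi vs by (auto simp: n_def)
    fix v assume "v \<in> verts G"
    then obtain k where k: "k < n" "v = vs ! k" unfolding n_def using vs(1) by (metis in_set_conv_nth)
    have "(\<Sum>w\<in>{w \<in> verts G. v \<rightarrow>\<^bsub>G\<^esub> w}. f w) = (\<Sum>w\<in>verts G. if v \<rightarrow>\<^bsub>G\<^esub> w then f w else 0)"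
      using assms(1) by (simp add: sum.inter_filter)
    also have "\<dots> = (\<Sum>j<n. if v \<rightarrow>\<^bsub>G\<^esub> vs ! j then f (vs ! j) else 0)"
      by (rule sum.reindex_bij_betw[OF b, symmetric])
    also have "\<dots> = (A *\<^sub>v x) $ k"
      using k x(1) by (auto simp: fi A_def adjacency_matrix_def scalar_prod_def n_def[symmetric]
          atLeast0LessThan intro!: sum.cong)
    also have "\<dots> = l * f v" using k x fi by simp
    finally show "(\<Sum>w\<in>{w \<in> verts G. v \<rightarrow>\<^bsub>G\<^esub> w}. f w) = l * f v" .
  qed
qed

lemma (in wf_digraph) ex_awalk_of_path:
  assumes "successively (\<lambda>x y. x \<rightarrow>\<^bsub>G\<^esub> y) P" "P \<noteq> []" "set P \<subseteq> verts G"
  shows "\<exists>p. awalk (hd P) p (last P) \<and> awalk_verts (hd P) p = P"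
  using assms
proof (induction P rule: induct_list012)
  case (2 x)
  then show ?case by (intro exI[of _ "[]"]) (simp add: awalk_Nil_iff)
next
  case (3 x y zs)
  then obtain p where p: "awalk y p (last (y # zs))" "awalk_verts y p = y # zs" by auto
  from 3 obtain e where e: "e \<in> arcs G" "tail G e = x" "head G e = y" by auto
  with p 3 show ?case
    by (intro exI[of _ "e # p"]) (auto simp: awalk_def)
qed simp

lemma (in graph) ugraph_dominates: "ugraph (\<lambda>x y. x \<rightarrow>\<^bsub>G\<^esub> y)"
  using arcs_ends_symmetric[OF sym_arcs] adj_not_same by unfold_locales auto

lemma (in graph) traceableI:
  assumes "ugraph.ham (\<lambda>x y. x \<rightarrow>\<^bsub>G\<^esub> y) (verts G)" "verts G \<noteq> {}"
  shows "traceable G"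
proof -
  interpret ugraph "\<lambda>x y. x \<rightarrow>\<^bsub>G\<^esub> y" by (rule ugraph_dominates)
  obtain P where P: "distinct P" "successively (\<lambda>x y. x \<rightarrow>\<^bsub>G\<^esub> y) P" "set P = verts G"
    using assms(1) by (auto simp: ham_def path_in_def)
  then have "P \<noteq> []" using assms(2) by force
  then obtain p where "awalk (hd P) p (last P)" "awalk_verts (hd P) p = P"
    using ex_awalk_of_path[of P] P by auto
  then show ?thesis using P unfolding traceable_def apath_def by metis
qed

lemma (in graph) conn_verts:
  assumes "connected G"
  shows "ugraph.conn (\<lambda>x y. x \<rightarrow>\<^bsub>G\<^esub> y) (verts G)"
proof -
  interpret ugraph "\<lambda>x y. x \<rightarrow>\<^bsub>G\<^esub> y" by (rule ugraph_dominates)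
  \<comment> \<open>\<open>connected\<close> refers to the symmetric closure, which has the same
    reachability because \<open>G\<close> is symmetric.\<close>
  have re: "x \<rightarrow>\<^sup>*\<^bsub>G\<^esub> y" if "x \<in> verts G" "y \<in> verts G" for x y
    using assms that reachable_mk_symmetric_eq[OF sym_arcs]
    by (auto simp: connected_def strongly_connected_def)
  have ne: "verts G \<noteq> {}" using assms by (auto simp: connected_def strongly_connected_def)
  have "\<exists>x\<in>S. \<exists>y\<in>verts G - S. x \<rightarrow>\<^bsub>G\<^esub> y" if S: "S \<subseteq> verts G" "S \<noteq> {}" "S \<noteq> verts G" for S
  proof (rule ccontr)
    assume *: "\<not> ?thesis"
    \<comment> \<open>If no edge leaves \<open>S\<close>, reachability from \<open>x\<close> never
      leaves it either, although \<open>y\<close> is reachable.\<close>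
    obtain x y where xy: "x \<in> S" "y \<in> verts G" "y \<notin> S" using S by auto
    then have "x \<rightarrow>\<^sup>*\<^bsub>G\<^esub> y" using re S by auto
    then have "y \<in> S"
    proof (induction rule: reachable_induct)
      case base then show ?case using xy by simp
    next
      case (step u v)
      then show ?case using * adj_in_verts(2)[of u v] by auto
    qed
    with xy show False by simp
  qed
  with ne show ?thesis by (simp add: conn_def)
qed

lemma (in graph) clawfree_verts:
  assumes "claw_free G"
  shows "ugraph.clawfree (\<lambda>x y. x \<rightarrow>\<^bsub>G\<^esub> y) (verts G)"
proof -
  interpret ugraph "\<lambda>x y. x \<rightarrow>\<^bsub>G\<^esub> y" by (rule ugraph_dominates)
  show ?thesis unfolding clawfree_def
  proof (intro ballI impI, rule ccontr)
    fix c x y z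
    assume v: "c \<in> verts G" "x \<in> verts G" "y \<in> verts G" "z \<in> verts G"
      and e: "c \<rightarrow>\<^bsub>G\<^esub> x" "c \<rightarrow>\<^bsub>G\<^esub> y" "c \<rightarrow>\<^bsub>G\<^esub> z" and d: "x \<noteq> y" "x \<noteq> z" "y \<noteq> z"
      and n: "\<not> (x \<rightarrow>\<^bsub>G\<^esub> y \<or> x \<rightarrow>\<^bsub>G\<^esub> z \<or> y \<rightarrow>\<^bsub>G\<^esub> z)"
    let ?H = "G \<restriction> {c, x, y, z}"
    have ind: "induced_subgraph ?H G" using v by (intro induced_induce) auto
    have nc: "c \<noteq> x" "c \<noteq> y" "c \<noteq> z" using e irrefl by auto
    have "graph ?H"
    proof -
      interpret H: digraph ?H using digraphI_induced[OF ind] .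
      show ?thesis using induced_graph_imp_symmetric[OF sym_arcs ind] by (rule H.graphI)
    qed
    moreover have "arcs_ends ?H = {c} \<times> {x, y, z} \<union> {x, y, z} \<times> {c}"
    proof -
      have "arcs_ends ?H = {(u, w). u \<rightarrow>\<^bsub>G\<^esub> w \<and> u \<in> {c, x, y, z} \<and> w \<in> {c, x, y, z}}"
        by (auto simp: arcs_ends_conv induce_subgraph_def)
      also have "\<dots> = {c} \<times> {x, y, z} \<union> {x, y, z} \<times> {c}"
        using e e[THEN sym] n nonadj_sym[of x y] nonadj_sym[of x z] nonadj_sym[of y z] irrefl by auto
      finally show ?thesis .
    qed
    moreover have "verts ?H = {c} \<union> {x, y, z}" "{c} \<inter> {x, y, z} = {}" "card {c} = 1" "card {x, y, z} = 3"
      using nc d by auto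
    ultimately have "K\<^bsub>1,3\<^esub> ?H"
      unfolding complete_bipartite_digraph_def by blast
    with assms ind show False by (auto simp: claw_free_def)
  qed
qed

text \<open>The isomorphism sends a vertex to its index in \<open>L\<close> and an arc to the pair
  of indices of its ends; absence of parallel arcs makes the arc map injective.\<close>

lemma (in graph) digraph_iso_with_projI:
  assumes L: "distinct L" "set L = verts G" and H: "pverts H = {..<length L}" "parcs H \<subseteq> pverts H \<times> pverts H"
    and adj: "\<And>i j. i < length L \<Longrightarrow> j < length L \<Longrightarrow> L ! i \<rightarrow>\<^bsub>G\<^esub> L ! j \<longleftrightarrow> (i, j) \<in> parcs H"
  shows "digraph_iso G (with_proj H)"
proof -
  have b: "bij_betw ((!) L) {..<length L} (verts G)" using L by (auto intro!: bij_betw_nth)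
  define g where "g = inv_into {..<length L} ((!) L)"
  have bg: "bij_betw g (verts G) {..<length L}" unfolding g_def by (rule bij_betw_inv_into[OF b])
  have Lg: "L ! g v = v" if "v \<in> verts G" for v
    unfolding g_def using bij_betw_inv_into_right[OF b that] .
  have gl: "g v < length L" if "v \<in> verts G" for v using bij_betwE[OF bg] that by auto
  have gL: "g (L ! i) = i" if "i < length L" for i
    unfolding g_def using bij_betw_inv_into_left[OF b] that by auto
  let ?f = "\<lparr>iso_verts = g, iso_arcs = (\<lambda>e. (g (tail G e), g (head G e))), iso_head = snd, iso_tail = fst\<rparr>"
  have "inj_on g (verts G)" using bg by (rule bij_betw_imp_inj_on)
  moreover have "inj_on (\<lambda>e. (g (tail G e), g (head G e))) (arcs G)"
    using \<open>inj_on g (verts G)\<close> by (intro inj_onI no_multi_arcs) (auto simp: arc_to_ends_def dest: inj_onD)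
  ultimately have iso: "digraph_isomorphism ?f"
    using wf_digraph by (simp add: digraph_isomorphism_def)
  have "(\<lambda>e. (g (tail G e), g (head G e))) ` arcs G = parcs H"
  proof (intro equalityI subsetI)
    fix p assume "p \<in> (\<lambda>e. (g (tail G e), g (head G e))) ` arcs G"
    then obtain e where e: "e \<in> arcs G" "p = (g (tail G e), g (head G e))" by auto
    then have "tail G e \<rightarrow>\<^bsub>G\<^esub> head G e" by (auto intro: in_arcs_imp_in_arcs_ends)
    then show "p \<in> parcs H" using e adj[of "g (tail G e)" "g (head G e)"] gl Lg by simp
  next
    fix p assume p: "p \<in> parcs H"
    then obtain i j where ij: "p = (i, j)" "i < length L" "j < length L" using H by auto
    then obtain e where "e \<in> arcs G" "tail G e = L ! i" "head G e = L ! j" using adj p by blast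
    then show "p \<in> (\<lambda>e. (g (tail G e), g (head G e))) ` arcs G" using ij gL by force
  qed
  moreover have "g ` verts G = pverts H" using bg H by (simp add: bij_betw_def)
  ultimately have "with_proj H = app_iso ?f G" by (simp add: app_iso_def with_proj_def)
  with iso show ?thesis unfolding digraph_iso_def by blast
qed

lemma (in graph) net_iso:
  assumes n: "ugraph.net (\<lambda>x y. x \<rightarrow>\<^bsub>G\<^esub> y) (verts G) K a1 a2 a3 b1 b2 b3"
  shows "card (verts G) \<ge> 6 \<and> digraph_iso G (with_proj (clique_with_pendants (card (verts G) - 3) 3))"
proof -
  interpret ugraph "\<lambda>x y. x \<rightarrow>\<^bsub>G\<^esub> y" by (rule ugraph_dominates)
  note D = netD[OF n]
  have "K \<subseteq> verts G" using D(1) by blast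
  then have fK: "finite K" by (rule finite_subset) simp
  obtain ks where ks: "set ks = K - {a1, a2, a3}" "distinct ks"
    using finite_distinct_list[of "K - {a1, a2, a3}"] fK by auto
  \<comment> \<open>Attachment vertices first and pendant vertices last, so that
    \<open>L ! (m + k)\<close> hangs on \<open>L ! k\<close> as in
    \<open>clique_with_pendants m 3\<close>.\<close>
  define M where "M = [a1, a2, a3] @ ks"
  define L where "L = M @ [b1, b2, b3]"
  have M: "distinct M" "set M = K" using ks D(2,3) by (auto simp: M_def)
  have L: "distinct L" "set L = verts G" using M D(1,3,4) by (auto simp: L_def)
  define m where "m = length M"
  have m3: "3 \<le> m" by (simp add: m_def M_def)
  have cV: "card (verts G) = m + 3" using distinct_card[OF L(1)] L(2) by (simp add: L_def m_def)
  have lenL: "length L = m + 3" by (simp add: L_def m_def)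
  have La: "L ! 0 = a1" "L ! 1 = a2" "L ! 2 = a3" by (simp_all add: L_def M_def)
  have Lb: "L ! m = b1" "L ! (m + 1) = b2" "L ! (m + 2) = b3"
    by (simp_all add: L_def m_def nth_append)
  have LK: "L ! i \<in> K" if "i < m" for i using that M(2) by (auto simp: L_def m_def nth_append)
  have eqi: "L ! i = L ! j \<longleftrightarrow> i = j" if "i < m + 3" "j < m + 3" for i j
    using that L(1) lenL by (simp add: nth_eq_iff_index_eq)
  have Lin: "L ! i \<in> verts G" if "i < m + 3" for i using that L(2) lenL nth_mem by metis
  have pend: "L ! (m + k) \<rightarrow>\<^bsub>G\<^esub> L ! j \<longleftrightarrow> j = k" if kj: "k < 3" "j < m + 3" for k j
  proof -
    note P = D(6-8)[OF Lin[OF kj(2)]]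
    consider "k = 0" | "k = 1" | "k = 2" using kj(1) by linarith
    then show ?thesis
    proof cases
      case 1 then show ?thesis using P(1) eqi[of j 0] kj(2) La(1) Lb(1) by simp
    next
      case 2 then show ?thesis using P(2) eqi[of j 1] kj(2) m3 La(2) Lb(2) by simp
    next
      case 3 then show ?thesis using P(3) eqi[of j 2] kj(2) m3 La(3) Lb(3) by simp
    qed
  qed
  have "digraph_iso G (with_proj (clique_with_pendants m 3))"
  proof (rule digraph_iso_with_projI[OF L])
    show "pverts (clique_with_pendants m 3) = {..<length L}" by (simp add: clique_with_pendants_def lenL)
    show "parcs (clique_with_pendants m 3) \<subseteq> pverts (clique_with_pendants m 3) \<times> pverts (clique_with_pendants m 3)"
      using m3 by (auto simp: clique_with_pendants_def)
    fix i j assume "i < length L" "j < length L"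
    then have ij: "i < m + 3" "j < m + 3" by (simp_all add: lenL)
    have A: "(i, j) \<in> parcs (clique_with_pendants m 3) \<longleftrightarrow>
        (i < m \<and> j < m \<and> i \<noteq> j) \<or> (\<exists>k<3. (i = k \<and> j = m + k) \<or> (i = m + k \<and> j = k))"
      by (auto simp: clique_with_pendants_def)
    show "L ! i \<rightarrow>\<^bsub>G\<^esub> L ! j \<longleftrightarrow> (i, j) \<in> parcs (clique_with_pendants m 3)"
    proof (cases "i < m")
      case i: True
      show ?thesis
      proof (cases "j < m")
        case True
        then show ?thesis unfolding A using i m3 D(5)[OF LK[OF i] LK[OF True]] eqi[of i j] irrefl by auto
      next
        case False
        then obtain k where k: "j = m + k" "k < 3" using ij by (metis add_less_cancel_left le_Suc_ex not_less)
        show ?thesis unfolding A using pend[OF k(2) ij(1)] sym_iff[of "L ! i"] k i by auto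
      qed
    next
      case False
      then obtain k where k: "i = m + k" "k < 3" using ij by (metis add_less_cancel_left le_Suc_ex not_less)
      show ?thesis unfolding A using pend[OF k(2) ij(2)] k m3 by auto
    qed
  qed
  then show ?thesis using cV m3 by simp
qed

section \<open>Small graphs and the theorem\<close>

text \<open>A vertex off a longest path attaches with at least two path vertices on either side of
  its neighbour, which makes at least six vertices.\<close>

lemma (in ugraph) ham_if_small:
  assumes "finite V" "conn V" "clawfree V" "card V \<le> 5"
  shows "ham V"
proof (rule ccontr)
  assume nh: "\<not> ham V"
  obtain P where L: "longest V P" using ex_longest[OF assms(1)] by blast
  have P: "set P \<subseteq> V" "distinct P" "successively E P" using L by (auto simp: longest_def path_in_def)
  obtain v0 where "v0 \<in> V" using assms(2) by (auto simp: conn_def)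
  then have "path_in V [v0]" by (simp add: path_in_def)
  from longestD[OF L this] have ne: "P \<noteq> []" by auto
  obtain x u where xu: "x \<in> set P" "u \<in> V - set P" "E x u"
    using conn_edge_out[OF assms(2), of "set P"] P ne nh hamI[of P V] by auto
  then obtain i where i: "i < length P" "E u (P ! i)" using sym by (metis in_set_conv_nth)
  have "5 \<le> length P"
    using longest_not_last2[OF assms(3) L _ _ i] longest_not_hd2[OF assms(3) L _ _ i] xu by simp
  moreover have "card (insert u (set P)) \<le> card V" using xu P assms(1) by (intro card_mono) auto
  ultimately show False using assms(4) distinct_card[OF P(2)] xu by simp
qed

theorem theorem5:
  fixes G :: "('a, 'b) pre_digraph" and n :: nat
  assumes "Digraph.graph G"
    and "Digraph_Component.connected G"
    and "claw_free G"
    and "card (verts G) = n"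
    and "graph_spectral_radius G \<ge> real n - 4"
    and "\<not> (n \<ge> 6 \<and> digraph_iso G (with_proj (clique_with_pendants (n - 3) 3)))"
  shows "traceable G"
proof -
  interpret graph G by fact
  let ?E = "\<lambda>x y. x \<rightarrow>\<^bsub>G\<^esub> y" and ?V = "verts G"
  interpret ugraph ?E by (rule ugraph_dominates)
  have c: "conn ?V" by (rule conn_verts) fact
  have cf: "clawfree ?V" by (rule clawfree_verts) fact
  have ne: "?V \<noteq> {}" using c by (auto simp: conn_def)
  have "ham ?V"
  proof (rule ccontr)
    assume nh: "\<not> ham ?V"
    have n6: "6 \<le> n" using ham_if_small[OF finite_verts c cf] nh assms(4) by linarith
    obtain l f v0 where l: "cmod l = graph_spectral_radius G"
      and v0: "v0 \<in> ?V" "f v0 \<noteq> 0"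
      and eig: "\<And>v. v \<in> ?V \<Longrightarrow> (\<Sum>w\<in>{w \<in> ?V. v \<rightarrow>\<^bsub>G\<^esub> w}. f w) = l * f v"
      by (rule graph_eigenfunction[OF finite_verts ne]) blast
    have deg: "\<exists>w\<in>?V. v \<rightarrow>\<^bsub>G\<^esub> w" if "v \<in> ?V" for v
    proof -
      have "?V \<noteq> {v}" using n6 assms(4) by auto
      then show ?thesis using conn_ex_nbr[OF c that] by blast
    qed
    let ?m2 = "\<Sum>v\<in>?V. card {w \<in> ?V. v \<rightarrow>\<^bsub>G\<^esub> w}"
    \<comment> \<open>Squaring is monotone here because \<open>n6\<close> makes
      \<open>real n - 4\<close> nonnegative.\<close>
    have "(real n - 4)\<^sup>2 \<le> (cmod l)\<^sup>2" using assms(5) l n6 by (intro power_mono) auto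
    also have "\<dots> \<le> real ?m2 - real n + 1"
      using eigenvalue_bound_edges[OF finite_verts deg eig v0] assms(4) by simp
    finally have "real n * real n + 15 \<le> real ?m2 + 7 * real n"
      by (simp add: power2_eq_square algebra_simps)
    then have "n * n + 15 \<le> ?m2 + 7 * n"
      using of_nat_le_iff[of "n * n + 15" "?m2 + 7 * n", where ?'a = real] by simp
    \<comment> \<open>Complementing turns the lower bound \<open>n * n - 7 * n + 15\<close> on the
      degree sum into an upper bound \<open>6 * n - 15\<close> on \<open>nonedges\<close>.\<close>
    moreover have "?m2 + nonedges ?V + n = n * n" using sum_degrees[OF finite_verts] assms(4) by simp
    ultimately have "nonedges ?V + 15 \<le> 6 * card ?V" using assms(4) by simp
    then consider K a1 a2 a3 b1 b2 b3 where "net ?V K a1 a2 a3 b1 b2 b3"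
      | a1 a2 a3 b1 c b2 b3 where "triangle_net ?V a1 a2 a3 b1 c b2 b3"
      using nontraceable_dense[OF finite_verts c cf nh] by blast
    then show False
    proof cases
      case 1
      then show False using net_iso assms(4,6) by blast
    next
      case 2
      have "cmod l < 3" by (rule triangle_net_eigenvalue_less[OF 2 eig v0])
      moreover have "n = 7" using nonedges_triangle_net(2)[OF 2] assms(4) by simp
      ultimately show False using assms(5) l by simp
    qed
  qed
  then show ?thesis using traceableI ne by blast
qed

end
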